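(* Let $E$ be an arbitrary directed graph. (1) The following conditions are equivalent. (i) The graph $E$ satisfies Condition (L). (ii) No nonzero element of $F_E^\Gamma$ is periodic. (iii) $\Gamma$ acts freely on (the nonzero elements of) $M_E^\Gamma$. (2) The following conditions are equivalent. (i) The graph $E$ satisfies Condition (K). (ii) No nonzero element of $M_E^\Gamma/I$ is periodic for any $\Gamma$-order-ideal $I$ of $M_E^\Gamma$. (iii) The group $\Gamma$ acts freely on (the nonzero elements of) $M_E^\Gamma/I$ for any $\Gamma$-order-ideal $I$ of $M_E^\Gamma$.
   Context: Setup. $\Gamma=\{x^n\mid n\in\mathbb Z\}$ is the infinite cyclic group generated by $x$. $E$ is an arbitrary directed graph (not necessarily row-finite) with vertex set $E^0$, edge set $E^1$, source map $\mathbf s$ and range map $\mathbf r$. A vertex $v$ is regular if $\mathbf s^{-1}(v)$ is finite and nonempty, and an infinite emitter if $\mathbf s^{-1}(v)$ is infinite. For every infinite emitter $v$ and every finite nonempty $Z\subseteq \mathbf s^{-1}(v)$ introduce a symbol $q_Z=q_Z^v$, called an improper vertex; elements of $E^0$ are called proper vertices. $F_E^\Gamma$ is the free commutative $\Gamma$-monoid on all proper and improper vertices (these are called the generators): its elements are finite formal sums of monomials $x^m g$ ($m\in\mathbb Z$, $g$ a generator), and $x^n$ acts by $x^n(x^m g)=x^{n+m}g$. The relation $\to_1$ on $F_E^\Gamma-\{0\}$ is given, for all $a\in F_E^\Gamma$ and $m\in\mathbb Z$, by: (A1) $a+x^m v\to_1 a+\sum_{e\in \mathbf s^{-1}(v)}x^{m+1}\mathbf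 r(e)$ for $v$ regular; (A2) $a+x^m v\to_1 a+x^m q_Z+\sum_{e\in Z}x^{m+1}\mathbf r(e)$ for $v$ an infinite emitter and $Z\subseteq \mathbf s^{-1}(v)$ finite and nonempty; (A3) $a+x^m q_Z\to_1 a+x^m q_W+\sum_{e\in W-Z}x^{m+1}\mathbf r(e)$ for $v$ an infinite emitter and finite nonempty $Z\subsetneq W\subseteq \mathbf s^{-1}(v)$. $\sim$ is the congruence on $F_E^\Gamma$ generated by $\to_1$, and $M_E^\Gamma=F_E^\Gamma/\sim$ is the graph $\Gamma$-monoid, ordered by $[a]\le[b]$ if and only if $a+c\sim b$ for some $c\in F_E^\Gamma$. An element $a\in F_E^\Gamma$ is periodic if $a\sim x^n a$ for some positive integer $n$; an element $a$ of a $\Gamma$-monoid such as $M_E^\Gamma/I$ is periodic if $a=x^na$ for some positive integer $n$. A $\Gamma$-order-ideal of $M_E^\Gamma$ is a submonoid $I$ closed under the action of $\Gamma$ such that $a\le b$ and $b\in I$ imply $a\in I$. $M_E^\Gamma/I$ is the quotient by the congruence relating $a$ and $b$ if $a+i=b+j$ for some $i,j\in I$. $\Gamma$ acts freely on a set if $x^n a=a$ for an element $a$ of the set implies $n=0$. A cycle is a closed path $e_1\cdots e_n$, $n\geq 1$, with $\mathbf s(e_i)\neq \mathbf s(e_j)$ for $i\ne j$; it has an exit if some vertex on it emits an edge which is not on the cycle. Condition (L): every cycle has an exit. A closed simple path based at $v$ is a path $e_1\cdots e_n$, $n\ge1$, with $\mathbf s(e_1)=v=\mathbf r(e_n)$ and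 $\mathbf s(e_i)\neq v$ for $i>1$. Condition (K): for each vertex $v$ which lies on a closed simple path, there are at least two different closed simple paths based at $v$. *)

theory Defs
  imports "HOL-Library.Multiset" "HOL-Algebra.Group" "Graph_Theory.Arc_Walk"
begin

section \<open>Monoids with an action of the infinite cyclic group\<close>

text \<open>
  The element \<open>x^n\<close> of the infinite cyclic group \<open>\<Gamma>\<close> is represented by its exponent \<open>n :: int\<close>,
  so \<open>act M n a\<close> is \<open>x^n a\<close>. The underlying commutative monoids use the record of
  \<open>HOL-Algebra\<close>, hence \<open>\<otimes>\<close> and \<open>\<one>\<close> stand for the \<open>+\<close> and \<open>0\<close> of the
  additive notation.
\<close>

record 'a gamma_monoid = "'a monoid" +
  act :: "int \<Rightarrow> 'a \<Rightarrow> 'a"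

locale gamma_monoid = comm_monoid M for M :: "('a, 'm) gamma_monoid_scheme" (structure) +
  assumes act_closed: "a \<in> carrier M \<Longrightarrow> act M n a \<in> carrier M"
    and act_zero: "a \<in> carrier M \<Longrightarrow> act M 0 a = a"
    and act_add: "a \<in> carrier M \<Longrightarrow> act M (m + n) a = act M m (act M n a)"
    and act_mult: "a \<in> carrier M \<Longrightarrow> b \<in> carrier M \<Longrightarrow>
      act M n (a \<otimes> b) = act M n a \<otimes> act M n b"
    and act_one: "act M n \<one> = \<one>"

definition nonzero :: "('a, 'm) gamma_monoid_scheme \<Rightarrow> 'a set" where
  "nonzero M = carrier M - {\<one>\<^bsub>M\<^esub>}"

definition periodic :: "('a, 'm) gamma_monoid_scheme \<Rightarrow> 'a \<Rightarrow> bool" where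
  "periodic M a \<longleftrightarrow> (\<exists>n>0. a = act M n a)"

definition acts_freely_on :: "('a, 'm) gamma_monoid_scheme \<Rightarrow> 'a set \<Rightarrow> bool" where
  "acts_freely_on M S \<longleftrightarrow> (\<forall>a\<in>S. \<forall>n. act M n a = a \<longrightarrow> n = 0)"

definition gamma_congruence ::
  "('a, 'm) gamma_monoid_scheme \<Rightarrow> ('a \<times> 'a) set \<Rightarrow> bool" where
  "gamma_congruence M R \<longleftrightarrow> equiv (carrier M) R \<and>
    (\<forall>a b c d. (a, b) \<in> R \<and> (c, d) \<in> R \<longrightarrow> (a \<otimes>\<^bsub>M\<^esub> c, b \<otimes>\<^bsub>M\<^esub> d) \<in> R) \<and>
    (\<forall>n a b. (a, b) \<in> R \<longrightarrow> (act M n a, act M n b) \<in> R)"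

definition generated_congruence ::
  "('a, 'm) gamma_monoid_scheme \<Rightarrow> ('a \<times> 'a) set \<Rightarrow> ('a \<times> 'a) set" where
  "generated_congruence M S = \<Inter> {R. gamma_congruence M R \<and> S \<subseteq> R}"

text \<open>
  The unions in the operations below are over sets that are all equal when \<open>R\<close> is a congruence;
  see \<open>quotient_mult\<close> and \<open>quotient_act\<close>.
\<close>

definition quotient_monoid ::
  "('a, 'm) gamma_monoid_scheme \<Rightarrow> ('a \<times> 'a) set \<Rightarrow> 'a set gamma_monoid" where
  "quotient_monoid M R =
    \<lparr>carrier = carrier M // R,
     monoid.mult = (\<lambda>A B. \<Union>a\<in>A. \<Union>b\<in>B. R `` {a \<otimes>\<^bsub>M\<^esub> b}),
     one = R `` {\<one>\<^bsub>M\<^esub>},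
     act = (\<lambda>n A. \<Union>a\<in>A. R `` {act M n a})\<rparr>"

definition alg_le :: "('a, 'm) gamma_monoid_scheme \<Rightarrow> 'a \<Rightarrow> 'a \<Rightarrow> bool" where
  "alg_le M a b \<longleftrightarrow> (\<exists>c\<in>carrier M. a \<otimes>\<^bsub>M\<^esub> c = b)"

definition gamma_order_ideal :: "('a, 'm) gamma_monoid_scheme \<Rightarrow> 'a set \<Rightarrow> bool" where
  "gamma_order_ideal M I \<longleftrightarrow> submonoid I M \<and>
    (\<forall>n. \<forall>a\<in>I. act M n a \<in> I) \<and>
    (\<forall>a\<in>carrier M. \<forall>b\<in>I. alg_le M a b \<longrightarrow> a \<in> I)"

definition ideal_congruence ::
  "('a, 'm) gamma_monoid_scheme \<Rightarrow> 'a set \<Rightarrow> ('a \<times> 'a) set" where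
  "ideal_congruence M I = {(a, b). a \<in> carrier M \<and> b \<in> carrier M \<and>
    (\<exists>i\<in>I. \<exists>j\<in>I. a \<otimes>\<^bsub>M\<^esub> i = b \<otimes>\<^bsub>M\<^esub> j)}"

definition ideal_quotient ::
  "('a, 'm) gamma_monoid_scheme \<Rightarrow> 'a set \<Rightarrow> 'a set gamma_monoid" where
  "ideal_quotient M I = quotient_monoid M (ideal_congruence M I)"

lemma gamma_congruenceD:
  assumes "gamma_congruence M R"
  shows "equiv (carrier M) R"
    and "(a, b) \<in> R \<Longrightarrow> (c, d) \<in> R \<Longrightarrow> (a \<otimes>\<^bsub>M\<^esub> c, b \<otimes>\<^bsub>M\<^esub> d) \<in> R"
    and "(a, b) \<in> R \<Longrightarrow> (act M n a, act M n b) \<in> R"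
  using assms by (simp_all add: gamma_congruence_def)

lemma quotient_mult:
  assumes R: "gamma_congruence M R" and ab: "a \<in> carrier M" "b \<in> carrier M"
  shows "R `` {a} \<otimes>\<^bsub>quotient_monoid M R\<^esub> R `` {b} = R `` {a \<otimes>\<^bsub>M\<^esub> b}"
proof -
  note e = gamma_congruenceD(1)[OF R]
  have "congruent2 R R (\<lambda>a b. R `` {a \<otimes>\<^bsub>M\<^esub> b})"
    by (rule congruent2I', rule equiv_class_eq[OF e], rule gamma_congruenceD(2)[OF R])
  from UN_equiv_class2[OF e e this ab] show ?thesis
    by (simp add: quotient_monoid_def)
qed

lemma quotient_act:
  assumes R: "gamma_congruence M R" and a: "a \<in> carrier M"
  shows "act (quotient_monoid M R) n (R `` {a}) = R `` {act M n a}"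
proof -
  note e = gamma_congruenceD(1)[OF R]
  have "congruent R (\<lambda>a. R `` {act M n a})"
    by (rule congruentI, rule equiv_class_eq[OF e], rule gamma_congruenceD(3)[OF R])
  from UN_equiv_class[OF e this a] show ?thesis
    by (simp add: quotient_monoid_def)
qed

lemma gamma_monoid_quotient:
  assumes M: "gamma_monoid M" and R: "gamma_congruence M R"
  shows "gamma_monoid (quotient_monoid M R)"
proof -
  interpret gamma_monoid M by (rule M)
  have car: "carrier (quotient_monoid M R) = (\<lambda>a. R `` {a}) ` carrier M"
    by (auto simp: quotient_monoid_def quotient_def)
  have one: "\<one>\<^bsub>quotient_monoid M R\<^esub> = R `` {\<one>\<^bsub>M\<^esub>}" by (simp add: quotient_monoid_def)
  show ?thesis
    by unfold_locales
      (auto simp: car one quotient_mult[OF R] quotient_act[OF R] m_ac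
        act_closed act_zero act_add act_mult act_one)
qed

lemma ideal_congruenceI:
  "a \<in> carrier M \<Longrightarrow> b \<in> carrier M \<Longrightarrow> i \<in> I \<Longrightarrow> j \<in> I \<Longrightarrow>
    a \<otimes>\<^bsub>M\<^esub> i = b \<otimes>\<^bsub>M\<^esub> j \<Longrightarrow> (a, b) \<in> ideal_congruence M I"
  unfolding ideal_congruence_def by blast

lemma ideal_congruenceE:
  assumes "(a, b) \<in> ideal_congruence M I"
  obtains i j where "a \<in> carrier M" "b \<in> carrier M" "i \<in> I" "j \<in> I"
    "a \<otimes>\<^bsub>M\<^esub> i = b \<otimes>\<^bsub>M\<^esub> j"
  using assms unfolding ideal_congruence_def by blast

lemma gamma_congruence_ideal:
  assumes M: "gamma_monoid M" and I: "gamma_order_ideal M I"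
  shows "gamma_congruence M (ideal_congruence M I)"
proof -
  interpret gamma_monoid M by (rule M)
  interpret I: submonoid I M using I by (simp add: gamma_order_ideal_def)
  have sub: "i \<in> carrier M" if "i \<in> I" for i using that I.subset by blast
  have Iact: "act M n i \<in> I" if "i \<in> I" for i n
    using I that by (auto simp: gamma_order_ideal_def)
  have "trans (ideal_congruence M I)"
  proof (rule transI)
    fix a b c assume "(a, b) \<in> ideal_congruence M I" "(b, c) \<in> ideal_congruence M I"
    then obtain i j k l where *: "a \<in> carrier M" "b \<in> carrier M" "c \<in> carrier M"
      "i \<in> I" "j \<in> I" "k \<in> I" "l \<in> I" "a \<otimes>\<^bsub>M\<^esub> i = b \<otimes>\<^bsub>M\<^esub> j" "b \<otimes>\<^bsub>M\<^esub> k = c \<otimes>\<^bsub>M\<^esub> l"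
      by (elim ideal_congruenceE)
    have "a \<otimes>\<^bsub>M\<^esub> (i \<otimes>\<^bsub>M\<^esub> k) = (a \<otimes>\<^bsub>M\<^esub> i) \<otimes>\<^bsub>M\<^esub> k"
      using *(1-7) sub by (simp add: m_assoc)
    also have "\<dots> = (b \<otimes>\<^bsub>M\<^esub> j) \<otimes>\<^bsub>M\<^esub> k" using * by simp
    also have "\<dots> = (b \<otimes>\<^bsub>M\<^esub> k) \<otimes>\<^bsub>M\<^esub> j" using *(1-7) sub by (simp add: m_ac)
    also have "\<dots> = (c \<otimes>\<^bsub>M\<^esub> l) \<otimes>\<^bsub>M\<^esub> j" using * by simp
    also have "\<dots> = c \<otimes>\<^bsub>M\<^esub> (l \<otimes>\<^bsub>M\<^esub> j)" using *(1-7) sub by (simp add: m_assoc)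
    finally show "(a, c) \<in> ideal_congruence M I"
      by (rule ideal_congruenceI[rotated 4]) (simp_all add: *(1-7))
  qed
  moreover have "sym (ideal_congruence M I)"
    by (rule symI, elim ideal_congruenceE, rule ideal_congruenceI[rotated 4], erule sym)
  moreover have "refl_on (carrier M) (ideal_congruence M I)"
    by (rule refl_onI, rule ideal_congruenceI[where i = "\<one>\<^bsub>M\<^esub>" and j = "\<one>\<^bsub>M\<^esub>"]) simp_all
  ultimately have "equiv (carrier M) (ideal_congruence M I)"
    by (intro equivI) (auto simp: ideal_congruence_def)
  moreover have "(a \<otimes>\<^bsub>M\<^esub> c, b \<otimes>\<^bsub>M\<^esub> d) \<in> ideal_congruence M I"
    if "(a, b) \<in> ideal_congruence M I" "(c, d) \<in> ideal_congruence M I" for a b c d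
  proof -
    from that obtain i j k l where *: "a \<in> carrier M" "b \<in> carrier M" "c \<in> carrier M" "d \<in> carrier M"
      "i \<in> I" "j \<in> I" "k \<in> I" "l \<in> I" "a \<otimes>\<^bsub>M\<^esub> i = b \<otimes>\<^bsub>M\<^esub> j" "c \<otimes>\<^bsub>M\<^esub> k = d \<otimes>\<^bsub>M\<^esub> l"
      by (elim ideal_congruenceE)
    have "(a \<otimes>\<^bsub>M\<^esub> c) \<otimes>\<^bsub>M\<^esub> (i \<otimes>\<^bsub>M\<^esub> k) = (a \<otimes>\<^bsub>M\<^esub> i) \<otimes>\<^bsub>M\<^esub> (c \<otimes>\<^bsub>M\<^esub> k)"
      using *(1-8) sub by (simp add: m_ac)
    also have "\<dots> = (b \<otimes>\<^bsub>M\<^esub> j) \<otimes>\<^bsub>M\<^esub> (d \<otimes>\<^bsub>M\<^esub> l)" using * by simp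
    also have "\<dots> = (b \<otimes>\<^bsub>M\<^esub> d) \<otimes>\<^bsub>M\<^esub> (j \<otimes>\<^bsub>M\<^esub> l)"
      using *(1-8) sub by (simp add: m_ac)
    finally show ?thesis
      by (rule ideal_congruenceI[rotated 4]) (simp_all add: *(1-8))
  qed
  moreover have "(act M n a, act M n b) \<in> ideal_congruence M I"
    if ab: "(a, b) \<in> ideal_congruence M I" for n a b
  proof -
    from ab obtain i j where *: "a \<in> carrier M" "b \<in> carrier M" "i \<in> I" "j \<in> I"
      "a \<otimes>\<^bsub>M\<^esub> i = b \<otimes>\<^bsub>M\<^esub> j" by (elim ideal_congruenceE)
    then have "act M n a \<otimes>\<^bsub>M\<^esub> act M n i = act M n b \<otimes>\<^bsub>M\<^esub> act M n j"
      by (simp add: act_mult[symmetric] sub)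
    then show ?thesis
      by (rule ideal_congruenceI[rotated 4]) (simp_all add: *(1-4) Iact act_closed)
  qed
  ultimately show ?thesis unfolding gamma_congruence_def by blast
qed

lemma gamma_congruence_generated:
  assumes M: "gamma_monoid M" and S: "S \<subseteq> carrier M \<times> carrier M"
  shows "gamma_congruence M (generated_congruence M S)"
proof -
  interpret gamma_monoid M by (rule M)
  let ?C = "{R. gamma_congruence M R \<and> S \<subseteq> R}"
  have top: "carrier M \<times> carrier M \<in> ?C"
    using S by (auto simp: gamma_congruence_def act_closed intro!: equivI refl_onI symI transI)
  have eq: "equiv (carrier M) R" if "R \<in> ?C" for R
    using that by (simp add: gamma_congruence_def)
  have "\<Inter> ?C \<subseteq> carrier M \<times> carrier M" using top by blast
  moreover have "refl_on (carrier M) (\<Inter> ?C)"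
    using eq by (auto simp: equiv_def refl_on_def)
  moreover have "sym (\<Inter> ?C)"
    using eq unfolding equiv_def sym_def by blast
  moreover have "trans (\<Inter> ?C)"
    using eq unfolding equiv_def trans_def by blast
  ultimately have "equiv (carrier M) (\<Inter> ?C)" by (rule equivI)
  then show ?thesis
    unfolding generated_congruence_def by (auto simp: gamma_congruence_def)
qed


section \<open>The graph monoid\<close>

definition regular_vertex :: "('v, 'e) pre_digraph \<Rightarrow> 'v \<Rightarrow> bool" where
  "regular_vertex E v \<longleftrightarrow> v \<in> verts E \<and> finite (out_arcs E v) \<and> out_arcs E v \<noteq> {}"

definition infinite_emitter :: "('v, 'e) pre_digraph \<Rightarrow> 'v \<Rightarrow> bool" where
  "infinite_emitter E v \<longleftrightarrow> v \<in> verts E \<and> infinite (out_arcs E v)"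

text \<open>\<open>Improper v Z\<close> is the improper vertex \<open>q_Z^v\<close>.\<close>

datatype ('v, 'e) vertex_symbol = Proper 'v | Improper 'v "'e set"

definition generators :: "('v, 'e) pre_digraph \<Rightarrow> ('v, 'e) vertex_symbol set" where
  "generators E = Proper ` verts E \<union>
    {Improper v Z | v Z. infinite_emitter E v \<and> finite Z \<and> Z \<noteq> {} \<and> Z \<subseteq> out_arcs E v}"

text \<open>
  A finite formal sum of monomials \<open>x^m g\<close> is the finite multiset of the pairs \<open>(m, g)\<close>.
\<close>

type_synonym ('v, 'e) formal_sum = "(int \<times> ('v, 'e) vertex_symbol) multiset"

definition monomial :: "int \<Rightarrow> ('v, 'e) vertex_symbol \<Rightarrow> ('v, 'e) formal_sum" where
  "monomial m g = {#(m, g)#}"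

definition free_gamma_monoid ::
  "('v, 'e) pre_digraph \<Rightarrow> ('v, 'e) formal_sum gamma_monoid" where
  "free_gamma_monoid E =
    \<lparr>carrier = {a. snd ` set_mset a \<subseteq> generators E},
     monoid.mult = (+),
     one = {#},
     act = (\<lambda>n. image_mset (\<lambda>(m, g). (n + m, g)))\<rparr>"

inductive_set arrow1 ::
  "('v, 'e) pre_digraph \<Rightarrow> (('v, 'e) formal_sum \<times> ('v, 'e) formal_sum) set"
  for E :: "('v, 'e) pre_digraph" where
  A1: "a \<in> carrier (free_gamma_monoid E) \<Longrightarrow> regular_vertex E v \<Longrightarrow>
    (a + monomial m (Proper v),
     a + (\<Sum>e\<in>out_arcs E v. monomial (m + 1) (Proper (head E e)))) \<in> arrow1 E"
| A2: "a \<in> carrier (free_gamma_monoid E) \<Longrightarrow> infinite_emitter E v \<Longrightarrow>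
    finite Z \<Longrightarrow> Z \<noteq> {} \<Longrightarrow> Z \<subseteq> out_arcs E v \<Longrightarrow>
    (a + monomial m (Proper v),
     a + monomial m (Improper v Z) +
       (\<Sum>e\<in>Z. monomial (m + 1) (Proper (head E e)))) \<in> arrow1 E"
| A3: "a \<in> carrier (free_gamma_monoid E) \<Longrightarrow> infinite_emitter E v \<Longrightarrow>
    finite W \<Longrightarrow> Z \<noteq> {} \<Longrightarrow> Z \<subset> W \<Longrightarrow> W \<subseteq> out_arcs E v \<Longrightarrow>
    (a + monomial m (Improper v Z),
     a + monomial m (Improper v W) +
       (\<Sum>e\<in>W - Z. monomial (m + 1) (Proper (head E e)))) \<in> arrow1 E"

definition graph_congruence ::
  "('v, 'e) pre_digraph \<Rightarrow> (('v, 'e) formal_sum \<times> ('v, 'e) formal_sum) set" where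
  "graph_congruence E = generated_congruence (free_gamma_monoid E) (arrow1 E)"

definition graph_monoid ::
  "('v, 'e) pre_digraph \<Rightarrow> ('v, 'e) formal_sum set gamma_monoid" where
  "graph_monoid E = quotient_monoid (free_gamma_monoid E) (graph_congruence E)"

text \<open>
  For elements of the free monoid, periodicity is understood up to the congruence, not as
  \<open>periodic (free_gamma_monoid E)\<close>.
\<close>

definition periodic_sum :: "('v, 'e) pre_digraph \<Rightarrow> ('v, 'e) formal_sum \<Rightarrow> bool" where
  "periodic_sum E a \<longleftrightarrow> (\<exists>n>0. (a, act (free_gamma_monoid E) n a) \<in> graph_congruence E)"

lemma gamma_monoid_free: "gamma_monoid (free_gamma_monoid E)"
  by unfold_locales
    (auto simp: free_gamma_monoid_def ac_simps multiset.map_comp o_def case_prod_unfold)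

lemma arrow1_carrier:
  assumes "wf_digraph E"
  shows "arrow1 E \<subseteq> carrier (free_gamma_monoid E) \<times> carrier (free_gamma_monoid E)"
proof -
  interpret wf_digraph E by fact
  interpret F: gamma_monoid "free_gamma_monoid E" by (rule gamma_monoid_free)
  have add: "a + b \<in> carrier (free_gamma_monoid E)"
    if "a \<in> carrier (free_gamma_monoid E)" "b \<in> carrier (free_gamma_monoid E)" for a b
    using that by (auto simp: free_gamma_monoid_def)
  have sum: "(\<Sum>e\<in>Z. monomial m (Proper (head E e))) \<in> carrier (free_gamma_monoid E)"
    if "Z \<subseteq> arcs E" for Z m
    using that
    by (induction Z rule: infinite_finite_induct)
      (auto simp: free_gamma_monoid_def monomial_def generators_def)
  have gen: "monomial m g \<in> carrier (free_gamma_monoid E)" if "g \<in> generators E" for m g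
    using that by (simp add: free_gamma_monoid_def monomial_def)
  have proper: "Proper v \<in> generators E" if "v \<in> verts E" for v
    using that by (simp add: generators_def)
  have improper: "Improper v Z \<in> generators E"
    if "infinite_emitter E v" "finite Z" "Z \<noteq> {}" "Z \<subseteq> out_arcs E v" for v Z
    using that by (simp add: generators_def)
  have out: "out_arcs E v \<subseteq> arcs E" for v by (auto simp: out_arcs_def)
  show ?thesis
  proof (rule subrelI)
    fix a b assume "(a, b) \<in> arrow1 E"
    then show "(a, b) \<in> carrier (free_gamma_monoid E) \<times> carrier (free_gamma_monoid E)"
    proof cases
      case (A1 a v m)
      then have "v \<in> verts E" by (simp add: regular_vertex_def)
      then show ?thesis
        unfolding A1(1,2) using A1(3) out by (intro SigmaI add gen sum proper) simp_all
    next
      case (A2 a v Z m)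
      then have "v \<in> verts E" "Z \<subseteq> arcs E" using out by (auto simp: infinite_emitter_def)
      then show ?thesis
        unfolding A2(1,2) using A2(3-) by (intro SigmaI add gen sum proper improper) simp_all
    next
      case (A3 a v W Z m)
      then have "finite Z" "Z \<subseteq> out_arcs E v" "W \<noteq> {}" "W - Z \<subseteq> arcs E"
        using out[of v] by (auto intro: finite_subset)
      then show ?thesis
        unfolding A3(1,2) using A3(3-) by (intro SigmaI add gen sum improper) simp_all
    qed
  qed
qed

lemma gamma_congruence_graph:
  "wf_digraph E \<Longrightarrow> gamma_congruence (free_gamma_monoid E) (graph_congruence E)"
  unfolding graph_congruence_def
  by (rule gamma_congruence_generated[OF gamma_monoid_free arrow1_carrier])

lemma gamma_monoid_graph: "wf_digraph E \<Longrightarrow> gamma_monoid (graph_monoid E)"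
  unfolding graph_monoid_def
  by (rule gamma_monoid_quotient[OF gamma_monoid_free gamma_congruence_graph])

lemma gamma_monoid_ideal_quotient:
  "wf_digraph E \<Longrightarrow> gamma_order_ideal (graph_monoid E) I \<Longrightarrow>
    gamma_monoid (ideal_quotient (graph_monoid E) I)"
  unfolding ideal_quotient_def
  by (rule gamma_monoid_quotient[OF gamma_monoid_graph gamma_congruence_ideal[OF gamma_monoid_graph]])


section \<open>Conditions (L) and (K)\<close>

text \<open>
  The vertices on a closed path are the sources of its edges. The predicate \<open>awalk v p v\<close> says
  that the edges in the list \<open>p\<close> form a path from \<open>v\<close> to \<open>v\<close>.
\<close>

definition graph_cycle :: "('v, 'e) pre_digraph \<Rightarrow> 'e list \<Rightarrow> bool" where
  "graph_cycle E p \<longleftrightarrow>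
    p \<noteq> [] \<and> (\<exists>v. pre_digraph.awalk E v p v) \<and> distinct (map (tail E) p)"

definition has_exit :: "('v, 'e) pre_digraph \<Rightarrow> 'e list \<Rightarrow> bool" where
  "has_exit E p \<longleftrightarrow> (\<exists>v \<in> tail E ` set p. \<exists>e \<in> out_arcs E v. e \<notin> set p)"

definition condition_L :: "('v, 'e) pre_digraph \<Rightarrow> bool" where
  "condition_L E \<longleftrightarrow> (\<forall>p. graph_cycle E p \<longrightarrow> has_exit E p)"

definition closed_simple_path :: "('v, 'e) pre_digraph \<Rightarrow> 'v \<Rightarrow> 'e list \<Rightarrow> bool" where
  "closed_simple_path E v p \<longleftrightarrow>
    p \<noteq> [] \<and> pre_digraph.awalk E v p v \<and> (\<forall>e \<in> set (tl p). tail E e \<noteq> v)"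

definition condition_K :: "('v, 'e) pre_digraph \<Rightarrow> bool" where
  "condition_K E \<longleftrightarrow>
    (\<forall>v. (\<exists>w p. closed_simple_path E w p \<and> v \<in> tail E ` set p) \<longrightarrow>
      (\<exists>p q. p \<noteq> q \<and> closed_simple_path E v p \<and> closed_simple_path E v q))"

end

theory Submission
  imports Defs
begin

text \<open>
  A \<open>\<Gamma>\<close>-order-ideal corresponds to a set \<open>H\<close> of generators that is closed in both directions under
  (A1)--(A3). Cut every vertex down to a finite set \<open>W v\<close> of its edges (all of them at a regular vertex)
  and follow walks outside \<open>H\<close>: for a formal sum \<open>a\<close>, let level \<open>j\<close> be the multiset of endpoints
  at degree \<open>j\<close> of the walks that start in the monomials of \<open>a\<close>. A vertex is dead if it is a sink or an
  infinite emitter that (A2) does not turn, modulo the ideal, into a vertex with finitely many edges.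
  If \<open>a \<sim> b\<close>, then for large \<open>W\<close> the dead parts of all levels of \<open>a\<close> and \<open>b\<close> agree, and so do
  all high levels. If \<open>a\<close> and \<open>x^n a\<close> agree modulo the ideal, the dead part is invariant under a shift
  by \<open>n\<close> and vanishes in low degrees, so nothing is dead; the sizes of the high levels never decrease and are
  periodic, hence constant, so each vertex there has exactly one edge leading outside \<open>H\<close>. As these
  vertices are finite in number, they contain a cycle all of whose exits lead into \<open>H\<close>. With \<open>H\<close>
  empty this contradicts (L), and in general it contradicts (K) because walks cannot leave \<open>H\<close>.

  Conversely, a vertex \<open>v\<close> on a cycle of length \<open>n\<close> whose exits are all killed satisfies
  \<open>v = x^n v\<close>. If (K) fails at \<open>v\<close>, the exits of the unique closed simple path at \<open>v\<close> never
  return to \<open>v\<close>, so they are killed by the ideal of everything that does not reach \<open>v\<close>, which does not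
  contain \<open>v\<close>.
\<close>


section \<open>Formal sums and induction over the graph congruence\<close>

lemma carrier_free [simp]:
  "a \<in> carrier (free_gamma_monoid E) \<longleftrightarrow> snd ` set_mset a \<subseteq> generators E"
  by (simp add: free_gamma_monoid_def)

lemma mult_free [simp]: "a \<otimes>\<^bsub>free_gamma_monoid E\<^esub> b = a + b"
  by (simp add: free_gamma_monoid_def)

lemma one_free [simp]: "\<one>\<^bsub>free_gamma_monoid E\<^esub> = {#}"
  by (simp add: free_gamma_monoid_def)

lemma act_free: "act (free_gamma_monoid E) n a = image_mset (\<lambda>(m, g). (n + m, g)) a"
  by (simp add: free_gamma_monoid_def)

lemma act_free_monomial [simp]:
  "act (free_gamma_monoid E) n (monomial m g) = monomial (n + m) g"
  by (simp add: act_free monomial_def)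

lemma snd_set_act_free [simp]:
  "snd ` set_mset (act (free_gamma_monoid E) n a) = snd ` set_mset a"
  by (simp add: act_free image_image case_prod_unfold)

lemma set_mset_sum_monomial [simp]:
  "finite X \<Longrightarrow> set_mset (\<Sum>e\<in>X. monomial m (f e)) = (\<lambda>e. (m, f e)) ` X"
  by (induction X rule: finite_induct) (auto simp: monomial_def)

lemma set_mset_monomial [simp]: "set_mset (monomial m g) = {(m, g)}"
  by (simp add: monomial_def)

text \<open>The carrier pairs satisfying \<open>P\<close> form a congruence that contains
  \<open>arrow1\<close>, and the generated congruence is the least such relation.\<close>

lemma (in wf_digraph) graph_congruence_induct [consumes 1, case_names arrow1 refl sym trans add act]:
  assumes ab: "(a, b) \<in> graph_congruence G"
    and arrow1: "\<And>a b. (a, b) \<in> arrow1 G \<Longrightarrow> P a b"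
    and refl: "\<And>a. P a a"
    and sym: "\<And>a b. P a b \<Longrightarrow> P b a"
    and trans: "\<And>a b c. P a b \<Longrightarrow> P b c \<Longrightarrow> P a c"
    and add: "\<And>a b c d. P a b \<Longrightarrow> P c d \<Longrightarrow> P (a + c) (b + d)"
    and act: "\<And>n a b. P a b \<Longrightarrow> P (act (free_gamma_monoid G) n a) (act (free_gamma_monoid G) n b)"
  shows "P a b"
proof -
  let ?F = "free_gamma_monoid G"
  let ?R = "{(a, b). a \<in> carrier ?F \<and> b \<in> carrier ?F \<and> P a b}"
  have "refl_on (carrier ?F) ?R"
    by (rule refl_onI) (simp add: refl)
  moreover have "Relation.sym ?R"
    by (rule symI) (simp add: sym)
  moreover have "Relation.trans ?R"
    by (rule transI) (simp, blast intro: trans)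
  moreover have "?R \<subseteq> carrier ?F \<times> carrier ?F" by blast
  ultimately have "equiv (carrier ?F) ?R" by (intro equivI)
  then have "gamma_congruence ?F ?R"
    by (simp add: gamma_congruence_def add act image_Un)
  moreover have "arrow1 G \<subseteq> ?R"
    using arrow1_carrier[OF wf_digraph_axioms] arrow1 by blast
  ultimately have "graph_congruence G \<subseteq> ?R"
    by (auto simp only: graph_congruence_def generated_congruence_def)
  with ab show ?thesis by blast
qed

lemma arrow1_graph_congruence: "arrow1 E \<subseteq> graph_congruence E"
  by (auto simp: graph_congruence_def generated_congruence_def)


section \<open>Sums of positive numbers and shift-invariant sequences\<close>

lemma sum_mset_const_one:
  fixes f :: "'a \<Rightarrow> nat"
  assumes "\<And>x. x \<in># M \<Longrightarrow> 1 \<le> f x" and "(\<Sum>x\<in>#M. f x) = size M" and "x \<in># M"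
  shows "f x = 1"
  using assms
proof (induction M)
  case (add y M)
  have ge: "size M \<le> (\<Sum>x\<in>#M. f x)"
    using sum_mset_mono[of M "\<lambda>_. 1" f] add.prems(1) by simp
  moreover have "1 \<le> f y" "f y + (\<Sum>x\<in>#M. f x) = Suc (size M)" using add.prems by auto
  ultimately have "f y = 1" "(\<Sum>x\<in>#M. f x) = size M" by linarith+
  then show ?case using add by auto
qed simp

lemma funpow_additive:
  fixes s :: "'a :: plus \<Rightarrow> 'a"
  assumes "\<And>M N. s (M + N) = s M + s N"
  shows "(s ^^ k) (M + N) = (s ^^ k) M + (s ^^ k) N"
  by (induction k) (simp_all add: assms)

lemma shift_invariant_int:
  fixes f :: "int \<Rightarrow> 'a"
  assumes shift: "\<And>j. f j = f (j - n)" and "n > 0" and below: "\<And>j. j < m \<Longrightarrow> f j = c"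
  shows "f j = c"
proof -
  have it: "f j = f (j - int k * n)" for k
  proof (induction k)
    case (Suc k)
    then show ?case using shift[of "j - int k * n"] by (simp add: algebra_simps)
  qed simp
  \<comment> \<open>Since \<open>n\<close> is at least 1, \<open>j - m + 1\<close> shifts by
    \<open>n\<close> lead below \<open>m\<close>; if \<open>j\<close> is already below
    \<open>m\<close>, \<open>nat\<close> turns this into 0 shifts.\<close>
  have "int (nat (j - m + 1)) * n \<ge> int (nat (j - m + 1))"
    using \<open>n > 0\<close> by (simp add: mult_le_cancel_left1)
  then have "j - int (nat (j - m + 1)) * n < m" by linarith
  then show ?thesis using it below by metis
qed

lemma finite_range_if_shift_invariant:
  fixes f :: "nat \<Rightarrow> 'a"
  assumes "\<And>i. f (i + n) = f i" and "n > 0"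
  shows "finite (range f)"
proof -
  have "f i \<in> f ` {..<n}" for i
  proof (induction i rule: less_induct)
    case (less i)
    show ?case
    proof (cases "i < n")
      case False
      then have "f i = f (i - n)" using assms(1)[of "i - n"] by simp
      then show ?thesis using less.IH[of "i - n"] False \<open>n > 0\<close> by simp
    qed simp
  qed
  then have "range f \<subseteq> f ` {..<n}" by blast
  then show ?thesis by (rule finite_subset) simp
qed

section \<open>Cycles from a successor map on a finite set\<close>

context wf_digraph
begin

text \<open>The orbit of \<open>y0\<close> under the successor map is finite, so it runs into a
  periodic point \<open>y\<close>. Following the chosen edges for the least period of
  \<open>y\<close> gives a closed path with distinct sources.\<close>

lemma graph_cycle_if_finite_successor_closed:
  assumes Y: "finite Y" "y0 \<in> Y"
    and \<epsilon>: "\<And>y. y \<in> Y \<Longrightarrow> \<epsilon> y \<in> out_arcs G y" "\<And>y. y \<in> Y \<Longrightarrow> head G (\<epsilon> y) \<in> Y"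
  obtains p where "graph_cycle G p" "tail G ` set p \<subseteq> Y" "\<And>e. e \<in> set p \<Longrightarrow> e = \<epsilon> (tail G e)"
proof -
  define f where "f y = head G (\<epsilon> y)" for y
  have iter: "(f ^^ i) y \<in> Y" if "y \<in> Y" for i y
    by (induction i) (simp_all add: that \<epsilon>(2) f_def)
  have "\<not> inj (\<lambda>i. (f ^^ i) y0)"
    using finite_subset[OF _ \<open>finite Y\<close>, of "range (\<lambda>i. (f ^^ i) y0)"] iter[OF \<open>y0 \<in> Y\<close>]
      finite_imageD[of "\<lambda>i. (f ^^ i) y0" UNIV] by auto
  then obtain i j where ij: "i < j" "(f ^^ i) y0 = (f ^^ j) y0"
    unfolding inj_def by (metis linorder_neqE_nat)
  define y where "y = (f ^^ i) y0"
  have yY: "y \<in> Y" using iter Y by (simp add: y_def)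
  have "(f ^^ (j - i)) y = y"
    using ij funpow_add[of "j - i" i f] by (simp add: y_def)
  then have ex: "0 < j - i \<and> (f ^^ (j - i)) y = y" using ij by simp
  define n where "n = (LEAST k. 0 < k \<and> (f ^^ k) y = y)"
  have n: "0 < n" "(f ^^ n) y = y" using LeastI[of "\<lambda>k. 0 < k \<and> (f ^^ k) y = y", OF ex]
    by (simp_all add: n_def)
  have min: "\<not> (0 < k \<and> k < n \<and> (f ^^ k) y = y)" for k
    using not_less_Least[of k "\<lambda>k. 0 < k \<and> (f ^^ k) y = y"] by (auto simp: n_def)
  have inj: "(f ^^ a) y \<noteq> (f ^^ b) y" if "a < b" "b < n" for a b
  proof
    assume "(f ^^ a) y = (f ^^ b) y"
    \<comment> \<open>Another \<open>n - b\<close> applications of \<open>f\<close> turn a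
      repetition into the period \<open>n - b + a\<close> of \<open>y\<close>, which is positive and
      below the least period \<open>n\<close>.\<close>
    then have "(f ^^ (n - b + a)) y = (f ^^ (n - b + b)) y" by (simp only: funpow_add o_apply)
    then have "(f ^^ (n - b + a)) y = y" using that n by simp
    moreover have "0 < n - b + a" "n - b + a < n" using that by auto
    ultimately show False using min by blast
  qed
  define p where "p = map (\<lambda>i. \<epsilon> ((f ^^ i) y)) [0..<n]"
  have tl: "tail G (\<epsilon> ((f ^^ i) y)) = (f ^^ i) y" for i using \<epsilon>(1)[OF iter[OF yY]] by simp
  have "y \<in> verts G" using \<epsilon>(1)[OF yY] tail_in_verts[of "\<epsilon> y"] by simp
  then have "awalk y (map (\<lambda>i. \<epsilon> ((f ^^ i) y)) [0..<k]) ((f ^^ k) y)" for k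
  proof (induction k)
    case (Suc k)
    have "awalk ((f ^^ k) y) [\<epsilon> ((f ^^ k) y)] ((f ^^ Suc k) y)"
      using \<epsilon>(1)[OF iter[OF yY, of k]] tail_in_verts[of "\<epsilon> ((f ^^ k) y)"]
      by (simp add: awalk_def f_def)
    then show ?case using Suc by (auto intro: awalk_appendI)
  qed (simp add: awalk_Nil_iff)
  from this[of n] have "awalk y p y" by (simp add: p_def n)
  moreover have "distinct (map (tail G) p)"
    unfolding p_def map_map o_def tl
    by (auto simp: distinct_map inj_on_def) (metis inj linorder_neqE_nat)
  ultimately have "graph_cycle G p"
    using n by (auto simp: graph_cycle_def p_def)
  moreover have "tail G ` set p \<subseteq> Y" using iter[OF yY] by (auto simp: p_def tl)
  moreover have "e = \<epsilon> (tail G e)" if "e \<in> set p" for e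
    using that by (auto simp: p_def tl)
  ultimately show ?thesis using that by blast
qed

end


section \<open>Levels of a formal sum\<close>

text \<open>Each equivalence reads one of (A1) to (A3) in both directions: from left to right
  \<open>H\<close> is hereditary, from right to left it is saturated.\<close>

locale saturated_generators = wf_digraph E for E :: "('v, 'e) pre_digraph" +
  fixes H :: "('v, 'e) vertex_symbol set"
  assumes subset_generators: "H \<subseteq> generators E"
    and regular_iff: "regular_vertex E v \<Longrightarrow>
      Proper v \<in> H \<longleftrightarrow> (\<forall>e\<in>out_arcs E v. Proper (head E e) \<in> H)"
    and emitter_iff: "infinite_emitter E v \<Longrightarrow> finite Z \<Longrightarrow> Z \<noteq> {} \<Longrightarrow> Z \<subseteq> out_arcs E v \<Longrightarrow>
      Proper v \<in> H \<longleftrightarrow> Improper v Z \<in> H \<and> (\<forall>e\<in>Z. Proper (head E e) \<in> H)"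
    and improper_iff: "infinite_emitter E v \<Longrightarrow> finite W \<Longrightarrow> Z \<noteq> {} \<Longrightarrow> Z \<subset> W \<Longrightarrow>
      W \<subseteq> out_arcs E v \<Longrightarrow>
      Improper v Z \<in> H \<longleftrightarrow> Improper v W \<in> H \<and> (\<forall>e\<in>W - Z. Proper (head E e) \<in> H)"
begin

lemma ImproperD:
  assumes "Improper v Z \<in> H"
  shows "infinite_emitter E v" "finite Z" "Z \<noteq> {}" "Z \<subseteq> out_arcs E v"
  using assms subset_generators by (auto simp: generators_def)

lemma head_mem:
  assumes "Proper (tail E e) \<in> H" "e \<in> arcs E"
  shows "Proper (head E e) \<in> H"
proof (cases "finite (out_arcs E (tail E e))")
  case True
  with assms(2) have "regular_vertex E (tail E e)" by (auto simp: regular_vertex_def)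
  from regular_iff[OF this] assms show ?thesis by auto
next
  case False
  with assms(2) have "infinite_emitter E (tail E e)" by (auto simp: infinite_emitter_def)
  from emitter_iff[OF this, of "{e}"] assms show ?thesis by auto
qed

lemma Improper_head_mem:
  assumes "Improper v Z \<in> H" "e \<in> out_arcs E v" "e \<notin> Z"
  shows "Proper (head E e) \<in> H"
  using improper_iff[of v "insert e Z" Z] ImproperD[OF assms(1)] assms by auto

lemma Improper_mem_if_Proper:
  assumes "Proper v \<in> H" "Improper v Z \<in> generators E"
  shows "Improper v Z \<in> H"
  using emitter_iff[of v Z] assms by (auto simp: generators_def)

lemma Improper_superset:
  assumes "Improper v Z \<in> H" "Z \<subseteq> W" "finite W" "W \<subseteq> out_arcs E v"
  shows "Improper v W \<in> H"
  using improper_iff[of v W Z] ImproperD[OF assms(1)] assms by (cases "Z = W") auto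

text \<open>This makes membership in the ideal given by \<open>H\<close> independent of the
  representative. For empty \<open>H\<close> it says that only the zero sum is congruent to
  zero.\<close>

lemma graph_congruence_subset_iff:
  assumes "(a, b) \<in> graph_congruence E"
  shows "snd ` set_mset a \<subseteq> H \<longleftrightarrow> snd ` set_mset b \<subseteq> H"
  using assms
proof (induction rule: graph_congruence_induct)
  case (arrow1 a b)
  then show ?case
  proof cases
    case (A1 a v m)
    then show ?thesis using regular_iff[OF A1(4)]
      by (auto simp: image_Un regular_vertex_def image_image)
  next
    case (A2 a v Z m)
    then show ?thesis using emitter_iff[OF A2(4-7)] by (auto simp: image_Un image_image)
  next
    case (A3 a v W Z m)
    then have "finite (W - Z)" by simp
    with A3(1,2) show ?thesis using improper_iff[OF A3(4-8)]
      by (auto simp: image_Un image_image)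
  qed
next
  case (add a b c d)
  then show ?case by (simp add: image_Un)
qed simp_all

text \<open>
  Modulo \<open>H\<close> such a vertex behaves like a regular one: if \<open>H\<close> contains \<open>Improper v Z\<close>, it contains the
  heads of all edges of \<open>v\<close> outside \<open>Z\<close>.
\<close>

definition breaking :: "'v \<Rightarrow> bool" where
  "breaking v \<longleftrightarrow> (\<exists>Z. Improper v Z \<in> H)"

definition alive :: "'v \<Rightarrow> bool" where
  "alive v \<longleftrightarrow> regular_vertex E v \<or> breaking v"

text \<open>At a breaking vertex the edges left out of \<open>W v\<close> lead into
  \<open>H\<close>, so nothing is lost modulo \<open>H\<close>. At any other infinite emitter
  \<open>W v\<close> is an arbitrary finite set of its edges.\<close>

definition admissible :: "('v \<Rightarrow> 'e set) \<Rightarrow> bool" where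
  "admissible W \<longleftrightarrow> (\<forall>v. finite (W v) \<and> W v \<subseteq> out_arcs E v \<and>
    (regular_vertex E v \<longrightarrow> W v = out_arcs E v) \<and> (breaking v \<longrightarrow> Improper v (W v) \<in> H))"

lemma admissibleD:
  assumes "admissible W"
  shows "finite (W v)" "W v \<subseteq> out_arcs E v" "regular_vertex E v \<Longrightarrow> W v = out_arcs E v"
    "breaking v \<Longrightarrow> Improper v (W v) \<in> H"
  using assms by (simp_all add: admissible_def)

lemma admissible_sup:
  assumes "admissible W" "\<And>v. finite (Z v)" "\<And>v. Z v \<subseteq> out_arcs E v"
  shows "admissible (\<lambda>v. W v \<union> Z v)"
  unfolding admissible_def
proof (intro allI conjI impI)
  fix v assume "breaking v"
  then show "Improper v (W v \<union> Z v) \<in> H"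
    using Improper_superset[OF admissibleD(4)[OF assms(1)], of v "W v \<union> Z v"] admissibleD[OF assms(1)] assms(2,3)
    by simp
next
  fix v assume "regular_vertex E v"
  then show "W v \<union> Z v = out_arcs E v" using admissibleD(3)[OF assms(1)] assms(3) by blast
qed (use admissibleD(1,2)[OF assms(1)] assms(2,3) in \<open>simp_all del: in_out_arcs_conv\<close>)

lemma ex_admissible: "\<exists>W. admissible W"
proof
  show "admissible (\<lambda>v. if regular_vertex E v then out_arcs E v
    else if breaking v then SOME Z. Improper v Z \<in> H else {})" (is "admissible ?W")
    unfolding admissible_def
  proof (intro allI)
    fix v
    have br: "Improper v (SOME Z. Improper v Z \<in> H) \<in> H" if "breaking v"
      using that unfolding breaking_def by (rule someI_ex)
    have "\<not> regular_vertex E v" if "breaking v"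
      using ImproperD(1)[OF br[OF that]] by (auto simp: regular_vertex_def infinite_emitter_def)
    with br ImproperD[OF br] show "finite (?W v) \<and> ?W v \<subseteq> out_arcs E v \<and>
      (regular_vertex E v \<longrightarrow> ?W v = out_arcs E v) \<and> (breaking v \<longrightarrow> Improper v (?W v) \<in> H)"
      by (auto simp: regular_vertex_def)
  qed
qed

text \<open>An "eventually" quantifier over the admissible \<open>W\<close>, which are directed
  under pointwise inclusion because unions are admissible. A derivation of a congruence involves
  only finitely many sets in (A2) and (A3), so a large enough \<open>W\<close> contains all of
  them.\<close>

definition for_large :: "(('v \<Rightarrow> 'e set) \<Rightarrow> bool) \<Rightarrow> bool" where
  "for_large P \<longleftrightarrow> (\<exists>W0. admissible W0 \<and> (\<forall>W. admissible W \<longrightarrow> W0 \<le> W \<longrightarrow> P W))"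

lemma for_large_conj:
  assumes "for_large P" "for_large Q"
  shows "for_large (\<lambda>W. P W \<and> Q W)"
proof -
  from assms obtain V W where VW: "admissible V" "\<forall>X. admissible X \<longrightarrow> V \<le> X \<longrightarrow> P X"
    "admissible W" "\<forall>X. admissible X \<longrightarrow> W \<le> X \<longrightarrow> Q X"
    unfolding for_large_def by blast
  then have "admissible (\<lambda>v. V v \<union> W v)" by (intro admissible_sup) (auto simp: admissible_def)
  moreover have "V \<le> X" "W \<le> X" if "(\<lambda>v. V v \<union> W v) \<le> X" for X
    using that by (auto simp: le_fun_def)
  ultimately show ?thesis using VW unfolding for_large_def by blast
qed

lemma for_large_mono: "for_large P \<Longrightarrow> (\<And>W. admissible W \<Longrightarrow> P W \<Longrightarrow> Q W) \<Longrightarrow> for_large Q"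
  unfolding for_large_def by blast

lemma for_largeE: "for_large P \<Longrightarrow> (\<And>W. admissible W \<Longrightarrow> P W \<Longrightarrow> thesis) \<Longrightarrow> thesis"
  unfolding for_large_def by blast

lemma for_large_superset:
  assumes "finite Z" "Z \<subseteq> out_arcs E v"
  shows "for_large (\<lambda>W. Z \<subseteq> W v)"
proof -
  from ex_admissible obtain W where "admissible W" by blast
  then have "admissible (\<lambda>u. W u \<union> (if u = v then Z else {}))"
    using assms by (intro admissible_sup) auto
  then show ?thesis unfolding for_large_def by (force simp: le_fun_def)
qed

lemma for_large_ball_finite: "finite X \<Longrightarrow> (\<And>x. x \<in> X \<Longrightarrow> for_large (P x)) \<Longrightarrow> for_large (\<lambda>W. \<forall>x\<in>X. P x W)"
proof (induction X rule: finite_induct)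
  case empty
  then show ?case using ex_admissible by (simp add: for_large_def)
next
  case (insert x X)
  then have "for_large (\<lambda>W. P x W \<and> (\<forall>x\<in>X. P x W))" by (intro for_large_conj) auto
  then show ?case by simp
qed

section \<open>Ends of walks outside \<open>H\<close> in the cut-down graph\<close>

definition base :: "'v \<Rightarrow> 'v multiset" where
  "base v = (if Proper v \<in> H then {#} else {#v#})"

definition heads :: "'e set \<Rightarrow> 'v multiset" where
  "heads X = (\<Sum>e\<in>X. base (head E e))"

text \<open>The transfer operator of the cut-down graph: all walks are prolonged by one edge, and
  those entering \<open>H\<close> are discarded by \<open>base\<close>.\<close>

definition step :: "('v \<Rightarrow> 'e set) \<Rightarrow> 'v multiset \<Rightarrow> 'v multiset" where
  "step W M = (\<Sum>u\<in>#M. heads (W u))"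

text \<open>
  \<open>Improper v Z\<close> stands for what is left of \<open>v\<close> once the edges in \<open>Z\<close> are removed. In length \<open>0\<close>
  it counts as \<open>v\<close>, which makes both sides of (A2) and (A3) have the same dead part.
\<close>

primrec ends :: "('v \<Rightarrow> 'e set) \<Rightarrow> nat \<Rightarrow> ('v, 'e) vertex_symbol \<Rightarrow> 'v multiset" where
  "ends W k (Proper v) = (step W ^^ k) (base v)"
| "ends W k (Improper v Z) =
    (case k of 0 \<Rightarrow> base v | Suc l \<Rightarrow> (step W ^^ l) (heads (W v - Z)))"

text \<open>Every edge raises the degree by one, so \<open>nat (j - m)\<close> is the length of a
  walk from degree \<open>m\<close> to degree \<open>j\<close>.\<close>

definition level :: "('v \<Rightarrow> 'e set) \<Rightarrow> int \<Rightarrow> ('v, 'e) formal_sum \<Rightarrow> 'v multiset" where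
  "level W j a = (\<Sum>(m, g)\<in>#a. if m \<le> j then ends W (nat (j - m)) g else {#})"

lemma step_add: "step W (M + N) = step W M + step W N"
  by (simp add: step_def)

lemma step_empty [simp]: "step W {#} = {#}"
  by (simp add: step_def)

lemma funpow_step_empty [simp]: "(step W ^^ k) {#} = {#}"
  by (induction k) auto

lemmas funpow_step_add = funpow_additive[of "step W" for W, OF step_add]

lemma funpow_step_sum:
  "(step W ^^ k) (\<Sum>x\<in>X. f x) = (\<Sum>x\<in>X. (step W ^^ k) (f x))"
  by (induction X rule: infinite_finite_induct) (simp_all add: funpow_step_add)

lemma heads_eq_empty_iff:
  "finite X \<Longrightarrow> heads X = {#} \<longleftrightarrow> (\<forall>e\<in>X. Proper (head E e) \<in> H)"
  unfolding heads_def by (induction X rule: finite_induct) (auto simp: base_def)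

lemma size_heads: "finite X \<Longrightarrow> size (heads X) = card {e \<in> X. Proper (head E e) \<notin> H}"
  unfolding heads_def
  by (induction X rule: finite_induct)
    (auto simp: base_def Collect_conv_if conj_disj_distribR Collect_disj_eq card_insert_if)

lemma mem_heads_iff: "finite X \<Longrightarrow> u \<in># heads X \<longleftrightarrow> (\<exists>e\<in>X. head E e = u \<and> Proper u \<notin> H)"
  unfolding heads_def by (induction X rule: finite_induct) (auto simp: base_def)

text \<open>If \<open>v\<close> is in \<open>H\<close>, both sides are empty, because edges never
  lead out of \<open>H\<close>.\<close>

lemma step_base:
  assumes "admissible W"
  shows "step W (base v) = heads (W v)"
proof (cases "Proper v \<in> H")
  case True
  then have "heads (W v) = {#}"
    using admissibleD[OF assms, of v] head_mem by (auto simp: heads_eq_empty_iff)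
  then show ?thesis using True by (simp add: base_def)
qed (simp add: base_def step_def)

lemma level_add: "level W j (a + b) = level W j a + level W j b"
  by (simp add: level_def)

lemma level_monomial:
  "level W j (monomial m g) = (if m \<le> j then ends W (nat (j - m)) g else {#})"
  by (simp add: level_def monomial_def)

lemma level_sum: "level W j (\<Sum>x\<in>X. f x) = (\<Sum>x\<in>X. level W j (f x))"
  by (induction X rule: infinite_finite_induct) (simp_all add: level_add, simp_all add: level_def)

text \<open>The edges in \<open>X\<close> take up one of the \<open>j - m\<close> steps. This gives
  the right-hand sides of the relations the shape found in \<open>funpow_step_base\<close> and
  \<open>ends_Improper\<close>.\<close>

lemma level_heads:
  "level W j (\<Sum>e\<in>X. monomial (m + 1) (Proper (head E e))) =
    (if m < j then (step W ^^ (nat (j - m) - 1)) (heads X) else {#})"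
  by (auto simp: level_sum level_monomial heads_def funpow_step_sum nat_diff_distrib
      intro!: sum.cong arg_cong[where f = "\<lambda>k. (step W ^^ k) _"])

lemma level_act: "level W j (act (free_gamma_monoid E) n a) = level W (j - n) a"
  by (simp add: level_def act_free image_mset.compositionality o_def case_prod_unfold algebra_simps
      cong: if_cong)

text \<open>This is the invariant of the congruence. (A1) can remove an alive vertex from the level
  of its degree, so equality of all levels would be too strong; dead vertices and high levels are
  not affected.\<close>

definition similar :: "('v \<Rightarrow> 'e set) \<Rightarrow> ('v, 'e) formal_sum \<Rightarrow> ('v, 'e) formal_sum \<Rightarrow> bool" where
  "similar W a b \<longleftrightarrow>
    (\<forall>j. filter_mset (\<lambda>v. \<not> alive v) (level W j a) = filter_mset (\<lambda>v. \<not> alive v) (level W j b)) \<and>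
    (\<exists>N. \<forall>j\<ge>N. level W j a = level W j b)"

lemma similar_refl: "similar W a a"
  by (simp add: similar_def)

lemma similar_sym: "similar W a b \<Longrightarrow> similar W b a"
  by (auto simp: similar_def) metis

lemma similar_trans:
  assumes "similar W a b" "similar W b c"
  shows "similar W a c"
proof -
  from assms obtain N N' where
    "\<forall>j\<ge>N. level W j a = level W j b" "\<forall>j\<ge>N'. level W j b = level W j c"
    by (auto simp: similar_def)
  then have "\<forall>j\<ge>max N N'. level W j a = level W j c" by simp
  with assms show ?thesis unfolding similar_def by metis
qed

lemma similar_add:
  assumes "similar W a b" "similar W c d"
  shows "similar W (a + c) (b + d)"
proof -
  from assms obtain N N' where
    "\<forall>j\<ge>N. level W j a = level W j b" "\<forall>j\<ge>N'. level W j c = level W j d"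
    by (auto simp: similar_def)
  then have "\<forall>j\<ge>max N N'. level W j (a + c) = level W j (b + d)" by (simp add: level_add)
  then have "\<exists>N. \<forall>j\<ge>N. level W j (a + c) = level W j (b + d)" by blast
  with assms show ?thesis by (simp add: similar_def level_add)
qed

lemma similar_act:
  assumes "similar W a b"
  shows "similar W (act (free_gamma_monoid E) n a) (act (free_gamma_monoid E) n b)"
proof -
  from assms obtain N where "\<forall>j\<ge>N. level W j a = level W j b"
    by (auto simp: similar_def)
  then have "\<forall>j\<ge>N + n. level W (j - n) a = level W (j - n) b" by simp
  with assms show ?thesis unfolding similar_def by (auto simp: level_act)
qed

lemma similarI:
  assumes "filter_mset (\<lambda>v. \<not> alive v) (level W m a) = filter_mset (\<lambda>v. \<not> alive v) (level W m b)"
    and "\<And>j. j < m \<Longrightarrow> level W j a = level W j b" "\<And>j. m < j \<Longrightarrow> level W j a = level W j b"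
  shows "similar W a b"
proof -
  have "\<forall>j\<ge>m + 1. level W j a = level W j b" using assms(3) by simp
  moreover have "filter_mset (\<lambda>v. \<not> alive v) (level W j a) = filter_mset (\<lambda>v. \<not> alive v) (level W j b)"
    for j using assms by (cases j m rule: linorder_cases) auto
  ultimately show ?thesis unfolding similar_def by blast
qed

lemma funpow_step_base:
  assumes "admissible W" "0 < k"
  shows "(step W ^^ k) (base v) = (step W ^^ (k - 1)) (heads (W v))"
  using assms by (cases k) (simp_all add: funpow_Suc_right step_base del: funpow.simps(2))

lemma ends_Improper:
  "0 < k \<Longrightarrow> ends W k (Improper v Z) = (step W ^^ (k - 1)) (heads (W v - Z))"
  by (cases k) simp_all

lemma ends_0 [simp]: "ends W 0 (Proper v) = base v" "ends W 0 (Improper v Z) = base v"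
  by simp_all

lemma heads_subset:
  assumes "finite X" "Z \<subseteq> X"
  shows "heads X = heads (X - Z) + heads Z"
  unfolding heads_def using sum.subset_diff[OF assms(2,1)] .

lemma filter_base: "alive v \<Longrightarrow> filter_mset (\<lambda>v. \<not> alive v) (base v) = {#}"
  by (simp add: base_def)

text \<open>Only the level at degree \<open>m\<close> can change. Above it, (A1) replaces
  \<open>v\<close> by its one-step successors, while (A2) and (A3) split the edges that remain at
  the vertex into those kept by the new improper vertex and those written out. The split requires
  the set of the new improper vertex to lie inside \<open>W v\<close>.\<close>

lemma arrow1_similar:
  assumes "(a, b) \<in> arrow1 E"
  shows "for_large (\<lambda>W. similar W a b)"
  using assms
proof cases
  case (A1 c v m)
  then have "alive v" by (simp add: alive_def)
  then have "similar W a b" if "admissible W" for W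
    unfolding A1(1,2) using A1(4) admissibleD(3)[OF that A1(4)]
    by (intro similar_add similar_refl similarI[of _ m])
      (auto simp: level_monomial level_heads funpow_step_base that filter_base)
  then show ?thesis using ex_admissible unfolding for_large_def by blast
next
  case (A2 c v Z m)
  have "similar W a b" if W: "admissible W" "Z \<subseteq> W v" for W
    unfolding A2(1,2) add.assoc using heads_subset[OF admissibleD(1)[OF W(1)] W(2)]
    by (intro similar_add similar_refl similarI[of _ m])
      (auto simp: level_monomial level_heads level_add funpow_step_base[OF W(1)] funpow_step_add
          ends_Improper simp del: ends.simps(2))
  then show ?thesis using for_large_superset[OF A2(5,7)] by (rule for_large_mono[rotated])
next
  case (A3 c v X Z m)
  have "similar W a b" if W: "admissible W" "X \<subseteq> W v" for W
  proof -
    \<comment> \<open>\<open>X\<close> is the larger set of (A3): the edges outside \<open>Z\<close>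
      are those outside \<open>X\<close> together with those in \<open>X - Z\<close>.\<close>
    have "heads (W v - Z) = heads (W v - X) + heads (X - Z)"
    proof -
      have "W v - Z - (X - Z) = W v - X" using A3(7) by blast
      then show ?thesis
        using heads_subset[of "W v - Z" "X - Z"] admissibleD(1)[OF W(1)] W(2) by auto
    qed
    then show ?thesis
      unfolding A3(1,2) add.assoc
      by (intro similar_add similar_refl similarI[of _ m])
        (auto simp: level_monomial level_heads level_add funpow_step_add ends_Improper simp del: ends.simps(2))
  qed
  then show ?thesis using for_large_superset[OF A3(5,8)] by (rule for_large_mono[rotated])
qed

lemma graph_congruence_similar:
  assumes "(a, b) \<in> graph_congruence E"
  shows "for_large (\<lambda>W. similar W a b)"
  using assms
proof (induction rule: graph_congruence_induct)
  case (refl a)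
  show ?case using ex_admissible by (auto simp: for_large_def similar_refl)
next
  case (sym a b)
  then show ?case by (rule for_large_mono) (rule similar_sym)
next
  case (trans a b c)
  from for_large_conj[OF this] show ?case by (rule for_large_mono) (auto intro: similar_trans)
next
  case (add a b c d)
  from for_large_conj[OF this] show ?case by (rule for_large_mono) (auto intro: similar_add)
next
  case (act n a b)
  then show ?case by (rule for_large_mono) (rule similar_act)
qed (rule arrow1_similar)

end


section \<open>Periodic sums produce cycles\<close>

context saturated_generators
begin

text \<open>Elements of the ideal are invisible to the invariant. An improper vertex
  \<open>Improper v Z\<close> in \<open>H\<close> counts as \<open>v\<close> in length 0, but then
  \<open>v\<close> is breaking and hence alive; longer walks start with an edge outside
  \<open>Z\<close>, which leads into \<open>H\<close>.\<close>

lemma ends_generator: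
  assumes "g \<in> H" "admissible W"
  shows "filter_mset (\<lambda>v. \<not> alive v) (ends W k g) = {#}" "0 < k \<Longrightarrow> ends W k g = {#}"
proof -
  have "(\<forall>k. filter_mset (\<lambda>v. \<not> alive v) (ends W k g) = {#}) \<and> (\<forall>k>0. ends W k g = {#})"
  proof (cases g)
    case (Proper v)
    then have "base v = {#}" using assms by (simp add: base_def)
    then show ?thesis using Proper by simp
  next
    case (Improper v Z)
    then have Z: "Improper v Z \<in> H" using assms by simp
    then have "alive v" by (auto simp: alive_def breaking_def)
    moreover have "heads (W v - Z) = {#}"
      using Improper_head_mem[OF Z] admissibleD[OF assms(2), of v] by (auto simp: heads_eq_empty_iff)
    ultimately show ?thesis
      using Improper by (auto simp: base_def split: nat.splits)
  qed
  then show "filter_mset (\<lambda>v. \<not> alive v) (ends W k g) = {#}" "0 < k \<Longrightarrow> ends W k g = {#}"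
    by blast+
qed

lemma not_alive_level_empty:
  assumes "snd ` set_mset i \<subseteq> H" "admissible W"
  shows "filter_mset (\<lambda>v. \<not> alive v) (level W j i) = {#}"
  using assms(1)
proof (induction i)
  case (add x i)
  then show ?case
    using ends_generator(1)[OF _ assms(2), of "snd x" "nat (j - fst x)"]
    by (simp add: level_def case_prod_unfold)
qed (simp add: level_def)

lemma level_eventually_empty:
  assumes "snd ` set_mset i \<subseteq> H" "admissible W" "\<And>m g. (m, g) \<in># i \<Longrightarrow> m < j"
  shows "level W j i = {#}"
proof -
  have "(case x of (m, g) \<Rightarrow> if m \<le> j then ends W (nat (j - m)) g else {#}) = {#}" if "x \<in># i" for x
  proof -
    have "snd x \<in> H" "fst x < j" using that assms(1) assms(3)[of "fst x" "snd x"] by auto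
    then show ?thesis
      using ends_generator(2)[OF _ assms(2), of "snd x" "nat (j - fst x)"]
      by (simp add: case_prod_unfold)
  qed
  then show ?thesis unfolding level_def by (simp cong: image_mset_cong)
qed

text \<open>If all edges in \<open>W v\<close> led into \<open>H\<close>, saturation by (A1) or (A2)
  would put \<open>v\<close> into \<open>H\<close>.\<close>

lemma heads_nonempty:
  assumes "admissible W" "alive v" "Proper v \<notin> H"
  shows "heads (W v) \<noteq> {#}"
proof (cases "regular_vertex E v")
  case True
  then show ?thesis
    using regular_iff[OF True] assms(3) admissibleD[OF assms(1), of v] by (auto simp: heads_eq_empty_iff)
next
  case False
  then have "Improper v (W v) \<in> H" using assms admissibleD(4) by (simp add: alive_def)
  then show ?thesis
    using emitter_iff[of v "W v"] ImproperD[of v "W v"] assms(3) by (auto simp: heads_eq_empty_iff)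
qed

text \<open>The size counts the edges in \<open>W v\<close> that lead outside \<open>H\<close>.
  Edges of \<open>v\<close> outside \<open>W v\<close> exist only if \<open>v\<close> is breaking,
  and then they lead into \<open>H\<close>, so the count covers all edges of
  \<open>v\<close>.\<close>

lemma unique_exit_if_size_heads:
  assumes W: "admissible W" and "alive v" and size: "size (heads (W v)) = 1"
  obtains e where "e \<in> out_arcs E v" "head E e \<in># heads (W v)"
    "\<And>e'. e' \<in> out_arcs E v \<Longrightarrow> e' \<noteq> e \<Longrightarrow> Proper (head E e') \<in> H"
proof -
  have "card {e \<in> W v. Proper (head E e) \<notin> H} = 1"
    using size size_heads[OF admissibleD(1)[OF W]] by simp
  then obtain e where e: "{e \<in> W v. Proper (head E e) \<notin> H} = {e}" by (auto simp: card_1_singleton_iff)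
  have "Proper (head E e') \<in> H" if "e' \<in> out_arcs E v" "e' \<noteq> e" for e'
  proof (cases "e' \<in> W v")
    case False
    then have "breaking v" using \<open>alive v\<close> that admissibleD(3)[OF W] by (auto simp: alive_def)
    from Improper_head_mem[OF admissibleD(4)[OF W this]] that False show ?thesis by simp
  qed (use e that in auto)
  moreover have "e \<in> W v" "Proper (head E e) \<notin> H" using e by auto
  ultimately show ?thesis
    using that[of e] admissibleD(1,2)[OF W, of v] by (auto simp: mem_heads_iff simp del: in_out_arcs_conv)
qed

text \<open>Above the degrees of all monomials no new walks start. The inequality is strict because
  the length 0 value of an improper vertex does not obey the recursion.\<close>

lemma level_Suc:
  assumes "admissible W" "\<And>m g. (m, g) \<in># a \<Longrightarrow> m < j"
  shows "level W (j + 1) a = step W (level W j a)"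
proof -
  have ends: "ends W (Suc k) g = step W (ends W k g)" if "0 < k" for k g
    using that by (cases g; cases k) simp_all
  have nat: "nat (j + 1 - m) = Suc (nat (j - m))" if "m < j" for m using that by simp
  show ?thesis
    using assms(2)
  proof (induction a)
    case (add x a)
    obtain m g where x: "x = (m, g)" by fastforce
    have "level W (j + 1) a = step W (level W j a)" using add by auto
    moreover have "m < j" using add.prems x by auto
    ultimately show ?case
      by (simp add: x level_def step_add nat ends)
  qed (simp add: level_def)
qed

lemma level_mem_subset:
  assumes "(m, g) \<in># a"
  shows "ends W k g \<subseteq># level W (m + int k) a"
proof -
  obtain b where "a = add_mset (m, g) b" using assms by (metis multi_member_split)
  then show ?thesis by (simp add: level_def)
qed

lemma not_mem_base: "u \<in># base v \<Longrightarrow> Proper u \<notin> H"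
  by (auto simp: base_def split: if_splits)

lemma not_mem_step: "admissible W \<Longrightarrow> u \<in># step W M \<Longrightarrow> Proper u \<notin> H"
  using admissibleD(1)[of W] by (auto simp: step_def mem_heads_iff)

lemma not_mem_ends:
  assumes "admissible W" "u \<in># ends W k g"
  shows "Proper u \<notin> H"
  using assms(2)
proof (cases g)
  case (Proper v)
  then show ?thesis using assms not_mem_step not_mem_base
    by (cases k) auto
next
  case (Improper v Z)
  show ?thesis
  proof (cases k)
    case (Suc l)
    then show ?thesis using assms Improper not_mem_step admissibleD(1)[OF assms(1), of v]
      by (cases l) (auto simp: mem_heads_iff)
  qed (use assms Improper not_mem_base in auto)
qed

lemma not_mem_level: "admissible W \<Longrightarrow> u \<in># level W j a \<Longrightarrow> Proper u \<notin> H"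
  by (auto simp: level_def not_mem_ends split: if_splits)

lemma step_nonempty:
  assumes "admissible W" "M \<noteq> {#}" "\<And>u. u \<in># M \<Longrightarrow> alive u \<and> Proper u \<notin> H"
  shows "step W M \<noteq> {#}"
proof -
  obtain u N where M: "M = add_mset u N" using assms(2) by (metis multiset_cases)
  then show ?thesis using heads_nonempty[OF assms(1)] assms(3)[of u]
    by (simp add: step_def)
qed

text \<open>Walks from a generator outside \<open>H\<close> never die out, because every end is
  alive and outside \<open>H\<close> and so has another edge. Only the first step from an improper
  vertex needs a separate argument.\<close>

lemma level_nonempty:
  assumes W: "admissible W" and mg: "(m, g) \<in># a" "g \<notin> H" "g \<in> generators E"
    and alive: "\<And>j u. u \<in># level W j a \<Longrightarrow> alive u"
    and Z: "\<And>v Z. g = Improper v Z \<Longrightarrow> Z \<subseteq> W v"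
    and "m < j"
  shows "level W j a \<noteq> {#}"
proof -
  have al: "alive u \<and> Proper u \<notin> H" if "u \<in># ends W k g" for u k
    using alive not_mem_ends[OF W that] mset_subset_eqD[OF level_mem_subset[OF mg(1)] that] by blast
  have "ends W (Suc k) g \<noteq> {#}" for k
  proof (induction k)
    case 0
    show ?case
    proof (cases g)
      case (Proper v)
      then have "ends W 0 g \<noteq> {#}" using mg by (simp add: base_def)
      then have "step W (ends W 0 g) \<noteq> {#}" by (rule step_nonempty[OF W _ al])
      then show ?thesis using Proper by simp
    next
      case (Improper v Z)
      have gen: "infinite_emitter E v" "finite Z" "Z \<noteq> {}" "Z \<subseteq> out_arcs E v"
        using mg(3) Improper by (auto simp: generators_def)
      have v: "Proper v \<notin> H" using Improper_mem_if_Proper mg Improper by blast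
      \<comment> \<open>Counting \<open>Improper v Z\<close> as \<open>v\<close> in length 0 makes
        \<open>v\<close> alive, and an alive infinite emitter is breaking. Thus
        \<open>Improper v (W v)\<close> is in \<open>H\<close>, and by (A3)
        \<open>Improper v Z\<close> would be too if all edges in \<open>W v - Z\<close> led into
        \<open>H\<close>.\<close>
      then have "v \<in># ends W 0 g" using Improper by (simp add: base_def)
      then have "alive v" using al by blast
      then have "breaking v" using gen by (auto simp: alive_def regular_vertex_def infinite_emitter_def)
      then have "Improper v (W v) \<in> H" by (rule admissibleD(4)[OF W])
      moreover have "Z \<subset> W v" using Z[OF Improper] mg(2) Improper calculation by auto
      ultimately have "\<not> (\<forall>e\<in>W v - Z. Proper (head E e) \<in> H)"
        using improper_iff[OF gen(1) admissibleD(1)[OF W] gen(3) _ admissibleD(2)[OF W]] mg(2) Improper by blast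
      then show ?thesis
        using Improper admissibleD(1)[OF W] by (simp add: heads_eq_empty_iff)
    qed
  next
    case (Suc k)
    have "ends W (Suc (Suc k)) g = step W (ends W (Suc k) g)" by (cases g) simp_all
    then show ?case using step_nonempty[OF W Suc] al by metis
  qed
  from this[of "nat (j - m) - 1"] have "ends W (nat (j - m)) g \<noteq> {#}" using \<open>m < j\<close> by simp
  with level_mem_subset[OF mg(1), of W "nat (j - m)"] \<open>m < j\<close> show ?thesis by auto
qed

lemma degree_bounds:
  "\<exists>l u :: int. \<forall>x\<in>#a. l < fst x \<and> fst x < u"
proof (induction a)
  case (add x a)
  then obtain l u where "\<forall>x\<in>#a. l < fst x \<and> fst x < u" by blast
  then have "\<forall>y\<in>#add_mset x a. min l (fst x - 1) < fst y \<and> fst y < max u (fst x + 1)" by auto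
  then show ?case by blast
qed simp

text \<open>The sums \<open>i\<close> and \<open>j\<close> are the error terms of an equality modulo
  the ideal; for empty \<open>H\<close> both are zero.\<close>

theorem cycle_if_periodic:
  assumes a: "a \<in> carrier (free_gamma_monoid E)" "\<not> snd ` set_mset a \<subseteq> H"
    and ij: "snd ` set_mset i \<subseteq> H" "snd ` set_mset j \<subseteq> H"
    and "n > 0"
    and per: "(a + i, act (free_gamma_monoid E) n a + j) \<in> graph_congruence E"
  obtains p where "graph_cycle E p"
    "\<And>e. e \<in> set p \<Longrightarrow> Proper (tail E e) \<notin> H"
    "\<And>e f. e \<in> set p \<Longrightarrow> f \<in> out_arcs E (tail E e) \<Longrightarrow> f \<noteq> e \<Longrightarrow> Proper (head E f) \<in> H"
proof -
  \<comment> \<open>\<open>X\<close> records the improper vertices of \<open>a\<close>; their edge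
    sets must lie inside \<open>W\<close> for \<open>level_nonempty\<close>.\<close>
  define X where "X = {(v, Z). Improper v Z \<in> snd ` set_mset a}"
  have "(\<lambda>(v, Z). Improper v Z) ` X \<subseteq> snd ` set_mset a" by (auto simp: X_def)
  then have "finite X"
    by (rule finite_imageD[OF finite_subset]) (auto intro!: inj_onI)
  then have "for_large (\<lambda>W. \<forall>x\<in>X. snd x \<subseteq> W (fst x))"
  proof (rule for_large_ball_finite)
    fix x assume "x \<in> X"
    then have "Improper (fst x) (snd x) \<in> generators E" using a(1) by (auto simp: X_def)
    then show "for_large (\<lambda>W. snd x \<subseteq> W (fst x))" by (intro for_large_superset) (auto simp: generators_def)
  qed
  from for_largeE[OF for_large_conj[OF this graph_congruence_similar[OF per]]] obtain W where
    W: "admissible W" "\<forall>x\<in>X. snd x \<subseteq> W (fst x)"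
    and sim: "similar W (a + i) (act (free_gamma_monoid E) n a + j)"
    by blast
  let ?L = "\<lambda>k. level W k a"
  let ?D = "\<lambda>k. filter_mset (\<lambda>v. \<not> alive v) (?L k)"
  obtain l u where bounds: "\<forall>x\<in>#a + i + j. l < fst x \<and> fst x < u" using degree_bounds by blast
  have lu: "l < m" if "(m, g) \<in># a" for m g using bounds that by force
  have ub: "m < u" if "(m, g) \<in># a + i + j" for m g using bounds that by force
  \<comment> \<open>The error terms have no dead ends, so the dead parts of \<open>a\<close> and of
    its shift by \<open>n\<close> coincide.\<close>
  have dead_shift: "?D k = ?D (k - n)" for k
    using sim not_alive_level_empty[OF _ W(1)] ij by (simp add: similar_def level_add level_act)
  have dead_below: "?D k = {#}" if "k < l" for k
  proof -
    have "\<not> m \<le> k" if "(m, g) \<in># a" for m g using lu[OF that] \<open>k < l\<close> by simp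
    then show ?thesis unfolding level_def by (subst sum_mset.neutral) auto
  qed
  have "?D k = {#}" for k
    by (rule shift_invariant_int[where f = ?D, OF dead_shift \<open>n > 0\<close> dead_below])
  then have "u \<notin># ?D k" for u k by simp
  then have alive: "alive u" if "u \<in># ?L k" for u k using that by simp
  from sim obtain N0 where N0: "\<And>k. k \<ge> N0 \<Longrightarrow> level W k (a + i) = level W (k - n) a + level W k j"
    by (auto simp: similar_def level_add level_act)
  \<comment> \<open>From \<open>N0\<close> on, whole levels agree. From \<open>u\<close> on,
    \<open>i\<close> and \<open>j\<close> contribute nothing and no walk of \<open>a\<close> starts,
    so \<open>q\<close> evolves by \<open>step\<close> alone.\<close>
  define N where "N = max N0 u"
  define q where "q k = ?L (N + int k)" for k
  have Lper: "?L k = ?L (k - n)" if "k \<ge> N" for k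
    using N0[of k] that level_eventually_empty[OF ij(1) W(1), of k]
      level_eventually_empty[OF ij(2) W(1), of k] ub
    by (fastforce simp: N_def level_add)
  have q_per: "q (k + nat n) = q k" for k
    using Lper[of "N + int k + n"] \<open>n > 0\<close> by (simp add: q_def algebra_simps)
  have q_Suc: "q (Suc k) = step W (q k)" for k
    using level_Suc[OF W(1), of a "N + int k"] ub by (force simp: q_def N_def algebra_simps)
  have q_alive: "alive v \<and> Proper v \<notin> H" if "v \<in># q k" for v k
    using that alive not_mem_level[OF W(1)] by (auto simp: q_def)
  from a(2) obtain m g where mg: "(m, g) \<in># a" "g \<notin> H"
    by (metis image_subset_iff prod.collapse)
  have q_nonempty: "q k \<noteq> {#}" for k
  proof -
    have "m < u" using ub[of m g] mg by auto
    moreover have "Z \<subseteq> W v" if "g = Improper v Z" for v Z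
    proof -
      have "(v, Z) \<in> X" using mg that unfolding X_def by force
      then show ?thesis using W(2) by force
    qed
    moreover have "g \<in> generators E" using a(1) mg by force
    ultimately show ?thesis
      unfolding q_def using mg alive by (intro level_nonempty[OF W(1), of m g]) (auto simp: N_def)
  qed
  have heads_ge: "1 \<le> size (heads (W v))" if "v \<in># q k" for v k
    using heads_nonempty[OF W(1)] q_alive[OF that] by (simp add: Suc_le_eq nonempty_has_size)
  have size_step: "size (step W M) = (\<Sum>v\<in>#M. size (heads (W v)))" for M
    by (induction M) (simp_all add: step_def)
  have mono: "size (q k) \<le> size (q (Suc k))" for k
    using sum_mset_mono[of "q k" "\<lambda>_. 1" "\<lambda>v. size (heads (W v))"] heads_ge
    by (auto simp: q_Suc size_step)
  \<comment> \<open>The sizes never decrease and return to the same value after \<open>n\<close>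
    steps.\<close>
  have size_eq: "size (q (Suc k)) = size (q k)" for k
  proof -
    have "size (q (Suc k)) \<le> size (q (k + nat n))"
      by (rule lift_Suc_mono_le[of "\<lambda>k. size (q k)"]) (use mono \<open>n > 0\<close> in auto)
    with mono[of k] show ?thesis by (simp add: q_per)
  qed
  \<comment> \<open>Each vertex of \<open>q k\<close> has at least one successor, and their total
    number is the number of vertices, so each has exactly one.\<close>
  have size1: "size (heads (W v)) = 1" if "v \<in># q k" for v k
    using sum_mset_const_one[of "q k" "\<lambda>v. size (heads (W v))" v] heads_ge size_eq[of k] that
    by (auto simp: q_Suc size_step)
  define Y where "Y = (\<Union>k. set_mset (q k))"
  have "finite (range q)"
    using finite_range_if_shift_invariant[of q "nat n"] q_per \<open>n > 0\<close> by simp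
  then have "finite (\<Union>M\<in>range q. set_mset M)" by (rule finite_UN_I) simp
  then have "finite Y" by (simp add: Y_def image_image)
  have "\<exists>e. e \<in> out_arcs E y \<and> head E e \<in> Y \<and>
    (\<forall>e'\<in>out_arcs E y. e' \<noteq> e \<longrightarrow> Proper (head E e') \<in> H)" if y: "y \<in> Y" for y
  proof -
    obtain k where k: "y \<in># q k" using y by (auto simp: Y_def)
    from unique_exit_if_size_heads[OF W(1) _ size1[OF k]] q_alive[OF k]
    obtain e where e: "e \<in> out_arcs E y" "head E e \<in># heads (W y)"
      "\<And>e'. e' \<in> out_arcs E y \<Longrightarrow> e' \<noteq> e \<Longrightarrow> Proper (head E e') \<in> H" by blast
    have "head E e \<in># q (Suc k)" unfolding q_Suc step_def using e(2) k by auto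
    then show ?thesis using e by (auto simp: Y_def)
  qed
  then obtain \<epsilon> where \<epsilon>: "\<And>y. y \<in> Y \<Longrightarrow> \<epsilon> y \<in> out_arcs E y" "\<And>y. y \<in> Y \<Longrightarrow> head E (\<epsilon> y) \<in> Y"
    "\<And>y e. y \<in> Y \<Longrightarrow> e \<in> out_arcs E y \<Longrightarrow> e \<noteq> \<epsilon> y \<Longrightarrow> Proper (head E e) \<in> H"
    by metis
  obtain y0 where "y0 \<in> Y" using q_nonempty[of 0] unfolding Y_def by (metis UNIV_I UN_I multiset_nonemptyE)
  from graph_cycle_if_finite_successor_closed[OF \<open>finite Y\<close> this \<epsilon>(1,2)]
  obtain p where p: "graph_cycle E p" "tail E ` set p \<subseteq> Y" "\<And>e. e \<in> set p \<Longrightarrow> e = \<epsilon> (tail E e)"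
    by blast
  show ?thesis
  proof (rule that[OF p(1)])
    fix e assume e: "e \<in> set p"
    then have Y: "tail E e \<in> Y" using p(2) by blast
    then show "Proper (tail E e) \<notin> H" using q_alive by (auto simp: Y_def)
    show "Proper (head E f) \<in> H" if "f \<in> out_arcs E (tail E e)" "f \<noteq> e" for f
      using \<epsilon>(3)[OF Y that(1)] p(3)[OF e] that(2) by simp
  qed
qed

end


section \<open>Order-ideals and quotients\<close>

text \<open>Freeness also concerns negative exponents, but an element fixed by \<open>n\<close> is
  fixed by \<open>- n\<close> too.\<close>

lemma acts_freely_iff_not_periodic:
  assumes "gamma_monoid M"
  shows "acts_freely_on M (nonzero M) \<longleftrightarrow> (\<forall>a\<in>nonzero M. \<not> periodic M a)"
proof
  assume "acts_freely_on M (nonzero M)"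
  then show "\<forall>a\<in>nonzero M. \<not> periodic M a"
    unfolding acts_freely_on_def periodic_def by (metis less_irrefl)
next
  interpret gamma_monoid M by fact
  assume np: "\<forall>a\<in>nonzero M. \<not> periodic M a"
  show "acts_freely_on M (nonzero M)"
    unfolding acts_freely_on_def
  proof (intro ballI allI impI)
    fix a n assume a: "a \<in> nonzero M" "act M n a = a"
    then have car: "a \<in> carrier M" by (simp add: nonzero_def)
    have "act M (- n) a = act M (- n + n) a" unfolding act_add[OF car] a(2) ..
    then have "a = act M (- n) a" by (simp add: act_zero[OF car])
    moreover have "\<not> (\<exists>k>0. a = act M k a)" using np a(1) by (auto simp: periodic_def)
    ultimately have "\<not> n > 0" "\<not> - n > 0" using a(2) by metis+
    then show "n = 0" by simp
  qed
qed

lemma (in gamma_monoid) order_ideal_mult_iff: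
  assumes I: "gamma_order_ideal M I" and ab: "a \<in> carrier M" "b \<in> carrier M"
  shows "a \<otimes> b \<in> I \<longleftrightarrow> a \<in> I \<and> b \<in> I"
proof
  assume mem: "a \<otimes> b \<in> I"
  moreover have "alg_le M a (a \<otimes> b)" "alg_le M b (a \<otimes> b)"
    unfolding alg_le_def using ab m_comm[OF ab] by metis+
  ultimately show "a \<in> I \<and> b \<in> I" using I ab by (auto simp: gamma_order_ideal_def)
next
  assume "a \<in> I \<and> b \<in> I"
  then show "a \<otimes> b \<in> I" using I by (auto simp: gamma_order_ideal_def intro: submonoid.m_closed)
qed

lemma (in gamma_monoid) order_ideal_act_iff:
  assumes I: "gamma_order_ideal M I" and a: "a \<in> carrier M"
  shows "act M n a \<in> I \<longleftrightarrow> a \<in> I"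
proof -
  have cl: "act M k b \<in> I" if "b \<in> I" for k b using I that by (simp add: gamma_order_ideal_def)
  have "act M (- n) (act M n a) = a" using act_add[OF a, of "- n" n] by (simp add: act_zero a)
  then show ?thesis using cl[of a n] cl[of "act M n a" "- n"] by auto
qed

text \<open>An element congruent to zero becomes a member of \<open>I\<close> after adding some
  \<open>i\<close> from \<open>I\<close>, so it lies below a member of \<open>I\<close> and hence in
  \<open>I\<close>.\<close>

lemma nonzero_ideal_quotient:
  fixes M :: "('a, 'm) gamma_monoid_scheme" (structure)
  assumes M: "gamma_monoid M" and I: "gamma_order_ideal M I"
  shows "nonzero (ideal_quotient M I) = (\<lambda>a. ideal_congruence M I `` {a}) ` (carrier M - I)"
proof -
  interpret gamma_monoid M by (rule M)
  interpret I: submonoid I M using I by (simp add: gamma_order_ideal_def)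
  have e: "equiv (carrier M) (ideal_congruence M I)"
    by (rule gamma_congruenceD(1)[OF gamma_congruence_ideal[OF M I]])
  have iff: "ideal_congruence M I `` {a} = ideal_congruence M I `` {\<one>} \<longleftrightarrow> a \<in> I"
    if a: "a \<in> carrier M" for a
  proof -
    have "(a, \<one>) \<in> ideal_congruence M I \<longleftrightarrow> a \<in> I"
    proof
      assume "(a, \<one>) \<in> ideal_congruence M I"
      then obtain i j where "i \<in> I" "j \<in> I" "a \<otimes> i = \<one> \<otimes> j" by (elim ideal_congruenceE)
      then have "a \<otimes> i \<in> I" using I.subset by auto
      with \<open>i \<in> I\<close> I.subset show "a \<in> I" using order_ideal_mult_iff[OF I a, of i] by blast
    next
      assume "a \<in> I"
      then show "(a, \<one>) \<in> ideal_congruence M I"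
        by (intro ideal_congruenceI[where i = \<one> and j = a]) (simp_all add: a)
    qed
    then show ?thesis using eq_equiv_class_iff[OF e a one_closed] by simp
  qed
  have "carrier (ideal_quotient M I) = (\<lambda>a. ideal_congruence M I `` {a}) ` carrier M"
    "\<one>\<^bsub>ideal_quotient M I\<^esub> = ideal_congruence M I `` {\<one>}"
    by (auto simp: ideal_quotient_def quotient_monoid_def quotient_def)
  moreover have "f ` C - {f x} = f ` (C - I)" if "\<And>a. a \<in> C \<Longrightarrow> f a = f x \<longleftrightarrow> a \<in> I"
    for f :: "'a \<Rightarrow> 'a set" and C x using that by blast
  from this[of "carrier M" "\<lambda>a. ideal_congruence M I `` {a}", OF iff]
  have "(\<lambda>a. ideal_congruence M I `` {a}) ` carrier M - {ideal_congruence M I `` {\<one>}} =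
    (\<lambda>a. ideal_congruence M I `` {a}) ` (carrier M - I)" .
  ultimately show ?thesis by (simp only: nonzero_def)
qed

lemma periodic_ideal_quotient:
  assumes M: "gamma_monoid M" and I: "gamma_order_ideal M I" and a: "a \<in> carrier M"
  shows "periodic (ideal_quotient M I) (ideal_congruence M I `` {a}) \<longleftrightarrow>
    (\<exists>n>0. (a, act M n a) \<in> ideal_congruence M I)"
proof -
  have R: "gamma_congruence M (ideal_congruence M I)" by (rule gamma_congruence_ideal[OF M I])
  show ?thesis
    unfolding periodic_def ideal_quotient_def quotient_act[OF R a]
    using eq_equiv_class_iff[OF gamma_congruenceD(1)[OF R] a gamma_monoid.act_closed[OF M a]]
    by simp
qed

section \<open>Representatives in the graph monoid, and generators of an order-ideal\<close>

context wf_digraph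
begin

abbreviation graph_class :: "('a, 'b) formal_sum \<Rightarrow> ('a, 'b) formal_sum set" where
  "graph_class a \<equiv> graph_congruence G `` {a}"

lemma carrier_graph_monoid:
  "carrier (graph_monoid G) = graph_class ` carrier (free_gamma_monoid G)"
  by (auto simp: graph_monoid_def quotient_monoid_def quotient_def)

lemma one_graph_monoid: "\<one>\<^bsub>graph_monoid G\<^esub> = graph_class {#}"
  by (simp add: graph_monoid_def quotient_monoid_def)

lemma mult_graph_monoid:
  "a \<in> carrier (free_gamma_monoid G) \<Longrightarrow> b \<in> carrier (free_gamma_monoid G) \<Longrightarrow>
    graph_class a \<otimes>\<^bsub>graph_monoid G\<^esub> graph_class b = graph_class (a + b)"
  using quotient_mult[OF gamma_congruence_graph[OF wf_digraph_axioms], of a b]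
  by (simp add: graph_monoid_def)

lemma act_graph_monoid:
  "a \<in> carrier (free_gamma_monoid G) \<Longrightarrow>
    act (graph_monoid G) n (graph_class a) = graph_class (act (free_gamma_monoid G) n a)"
  using quotient_act[OF gamma_congruence_graph[OF wf_digraph_axioms], of a n]
  by (simp add: graph_monoid_def)

lemma graph_class_eq_iff:
  "a \<in> carrier (free_gamma_monoid G) \<Longrightarrow> b \<in> carrier (free_gamma_monoid G) \<Longrightarrow>
    graph_class a = graph_class b \<longleftrightarrow> (a, b) \<in> graph_congruence G"
  by (rule eq_equiv_class_iff[OF gamma_congruenceD(1)[OF gamma_congruence_graph[OF wf_digraph_axioms]]])

lemma graph_class_eq_if_arrow1: "(a, b) \<in> arrow1 G \<Longrightarrow> graph_class a = graph_class b"
  using arrow1_graph_congruence[of G]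
    gamma_congruenceD(1)[OF gamma_congruence_graph[OF wf_digraph_axioms]]
  by (intro equiv_class_eq) blast+

text \<open>A sum lies in an order-ideal exactly if its summands do, and the action moves each
  monomial to degree 0. An order-ideal is therefore determined by its generators.\<close>

lemma graph_class_mem_order_ideal_iff:
  assumes I: "gamma_order_ideal (graph_monoid G) I" and a: "a \<in> carrier (free_gamma_monoid G)"
  shows "graph_class a \<in> I \<longleftrightarrow> snd ` set_mset a \<subseteq> {g \<in> generators G. graph_class (monomial 0 g) \<in> I}"
  using a
proof (induction a)
  case empty
  then show ?case
    using I submonoid.one_closed[of I "graph_monoid G"]
    by (simp add: gamma_order_ideal_def one_graph_monoid)
next
  case (add x a)
  interpret M: gamma_monoid "graph_monoid G" by (rule gamma_monoid_graph[OF wf_digraph_axioms])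
  obtain m g where x: "x = (m, g)" by fastforce
  have car: "a \<in> carrier (free_gamma_monoid G)" "monomial m g \<in> carrier (free_gamma_monoid G)"
    "monomial 0 g \<in> carrier (free_gamma_monoid G)" "g \<in> generators G"
    using add.prems by (auto simp: x)
  have cl: "graph_class b \<in> carrier (graph_monoid G)" if "b \<in> carrier (free_gamma_monoid G)" for b
    unfolding carrier_graph_monoid using that by (rule imageI)
  have "graph_class (add_mset x a) = graph_class (monomial m g) \<otimes>\<^bsub>graph_monoid G\<^esub> graph_class a"
    using mult_graph_monoid[OF car(2,1)] by (simp add: x monomial_def)
  moreover have "graph_class (monomial m g) = act (graph_monoid G) m (graph_class (monomial 0 g))"
    using act_graph_monoid[OF car(3), of m] by simp
  ultimately have "graph_class (add_mset x a) \<in> I \<longleftrightarrow> graph_class (monomial 0 g) \<in> I \<and> graph_class a \<in> I"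
    using M.order_ideal_mult_iff[OF I cl[OF car(2)] cl[OF car(1)]]
      M.order_ideal_act_iff[OF I cl[OF car(3)]] by simp
  then show ?case using add.IH[OF car(1)] car(4) by (auto simp: x)
qed

text \<open>The two sides of a relation have the same class, so they lie in \<open>I\<close>
  together; the axioms are the instances with no further summand and degree 0.\<close>

lemma saturated_generators_order_ideal:
  assumes I: "gamma_order_ideal (graph_monoid G) I"
  shows "saturated_generators G {g \<in> generators G. graph_class (monomial 0 g) \<in> I}"
    (is "saturated_generators G ?H")
proof -
  have ar: "snd ` set_mset a \<subseteq> ?H \<longleftrightarrow> snd ` set_mset b \<subseteq> ?H" if "(a, b) \<in> arrow1 G" for a b
  proof -
    have "a \<in> carrier (free_gamma_monoid G)" "b \<in> carrier (free_gamma_monoid G)"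
      using arrow1_carrier[OF wf_digraph_axioms] that by blast+
    note iff = this[THEN graph_class_mem_order_ideal_iff[OF I]]
    show ?thesis unfolding iff[symmetric] graph_class_eq_if_arrow1[OF that] ..
  qed
  show ?thesis
  proof unfold_locales
    fix v assume v: "regular_vertex G v"
    from ar[OF arrow1.A1[of "{#}" G v 0]] v
    show "Proper v \<in> ?H \<longleftrightarrow> (\<forall>e\<in>out_arcs G v. Proper (head G e) \<in> ?H)"
      by (simp add: regular_vertex_def image_image image_subset_iff del: in_out_arcs_conv mem_Collect_eq)
  next
    fix v Z assume v: "infinite_emitter G v" "finite Z" "Z \<noteq> {}" "Z \<subseteq> out_arcs G v"
    from ar[OF arrow1.A2[of "{#}" G v Z 0]] v
    show "Proper v \<in> ?H \<longleftrightarrow> Improper v Z \<in> ?H \<and> (\<forall>e\<in>Z. Proper (head G e) \<in> ?H)"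
      by (simp add: image_image image_subset_iff del: in_out_arcs_conv mem_Collect_eq)
  next
    fix v Z W assume v: "infinite_emitter G v" "finite W" "Z \<noteq> {}" "Z \<subset> W" "W \<subseteq> out_arcs G v"
    from ar[OF arrow1.A3[of "{#}" G v W Z 0]] v
    show "Improper v Z \<in> ?H \<longleftrightarrow> Improper v W \<in> ?H \<and> (\<forall>e\<in>W - Z. Proper (head G e) \<in> ?H)"
      by (simp add: image_image image_subset_iff del: in_out_arcs_conv mem_Collect_eq)
  qed blast
qed

text \<open>Round a closed walk this yields periodicity with the length of the walk. It serves both
  the free monoid with the graph congruence and the graph monoid with an ideal congruence.\<close>

lemma act_power_along_walk:
  assumes M: "gamma_monoid M" and R: "gamma_congruence M R"
    and c: "\<And>v. v \<in> verts G \<Longrightarrow> c v \<in> carrier M"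
    and p: "awalk u p w"
    and e: "\<And>e. e \<in> set p \<Longrightarrow> (c (tail G e), act M 1 (c (head G e))) \<in> R"
  shows "(c u, act M (int (length p)) (c w)) \<in> R"
  using p e
proof (induction p arbitrary: u)
  interpret gamma_monoid M by (rule M)
  case Nil
  then show ?case
    using gamma_congruenceD(1)[OF R] c
    by (auto simp: awalk_Nil_iff act_zero equiv_def refl_on_def)
next
  interpret gamma_monoid M by (rule M)
  case (Cons f p)
  have f: "f \<in> arcs G" "tail G f = u" "awalk (head G f) p w"
    using Cons.prems(1) by (auto simp: awalk_Cons_iff)
  then have "w \<in> verts G" by (simp add: awalk_last_in_verts)
  have "(act M 1 (c (head G f)), act M 1 (act M (int (length p)) (c w))) \<in> R"
    by (rule gamma_congruenceD(3)[OF R Cons.IH[OF f(3)]]) (simp add: Cons.prems(2))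
  moreover have "(c u, act M 1 (c (head G f))) \<in> R" using Cons.prems(2)[of f] f(2) by simp
  moreover have "act M 1 (act M (int (length p)) (c w)) = act M (int (length (f # p))) (c w)"
    using act_add[OF c[OF \<open>w \<in> verts G\<close>], of 1 "int (length p)"] by (simp add: add.commute)
  ultimately show ?case
    using gamma_congruenceD(1)[OF R] by (metis equiv_def transD)
qed

end

section \<open>The order-ideal of a saturated set of generators\<close>

context saturated_generators
begin

definition order_ideal :: "('v, 'e) formal_sum set set" where
  "order_ideal = graph_class ` {a. snd ` set_mset a \<subseteq> H}"

lemma graph_class_mem_order_ideal:
  assumes "a \<in> carrier (free_gamma_monoid E)"
  shows "graph_class a \<in> order_ideal \<longleftrightarrow> snd ` set_mset a \<subseteq> H"
proof
  assume "graph_class a \<in> order_ideal"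
  then obtain b where b: "snd ` set_mset b \<subseteq> H" "graph_class a = graph_class b" by (auto simp: order_ideal_def)
  then have "b \<in> carrier (free_gamma_monoid E)" using subset_generators by simp
  then have "(a, b) \<in> graph_congruence E" using b assms graph_class_eq_iff by blast
  from graph_congruence_subset_iff[OF this] b(1) show "snd ` set_mset a \<subseteq> H" by blast
qed (auto simp: order_ideal_def)

text \<open>All closure properties are read off representatives: \<open>a + b\<close> has the
  generators of \<open>a\<close> and of \<open>b\<close>, and the action keeps generators.\<close>

lemma gamma_order_ideal: "gamma_order_ideal (graph_monoid E) order_ideal"
proof -
  let ?F = "free_gamma_monoid E"
  have ex: "\<exists>a\<in>carrier ?F. x = graph_class a" if "x \<in> carrier (graph_monoid E)" for x
    using that by (auto simp only: carrier_graph_monoid)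
  have sub: "order_ideal \<subseteq> carrier (graph_monoid E)"
    unfolding order_ideal_def carrier_graph_monoid using subset_generators by auto
  have "x \<otimes>\<^bsub>graph_monoid E\<^esub> y \<in> order_ideal" if xy: "x \<in> order_ideal" "y \<in> order_ideal" for x y
  proof -
    obtain a b where ab: "a \<in> carrier ?F" "b \<in> carrier ?F" "x = graph_class a" "y = graph_class b"
      using xy sub ex by (meson subsetD)
    then have ab': "a + b \<in> carrier ?F" by auto
    show ?thesis
      using that graph_class_mem_order_ideal[OF ab(1)] graph_class_mem_order_ideal[OF ab(2)]
        graph_class_mem_order_ideal[OF ab'] mult_graph_monoid[OF ab(1,2)] ab(3,4) by (simp add: image_Un)
  qed
  moreover have "\<one>\<^bsub>graph_monoid E\<^esub> \<in> order_ideal"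
    by (simp add: one_graph_monoid graph_class_mem_order_ideal)
  moreover have "act (graph_monoid E) n x \<in> order_ideal" if x: "x \<in> order_ideal" for n x
  proof -
    obtain a where a: "a \<in> carrier ?F" "x = graph_class a"
      using x sub ex by (meson subsetD)
    then have a': "act ?F n a \<in> carrier ?F" by simp
    show ?thesis using that graph_class_mem_order_ideal[OF a(1)]
      graph_class_mem_order_ideal[OF a'] act_graph_monoid[OF a(1), of n] a(2) by simp
  qed
  moreover have "x \<in> order_ideal" if xy: "x \<in> carrier (graph_monoid E)" "y \<in> order_ideal"
    "alg_le (graph_monoid E) x y" for x y
  proof -
    from xy obtain z where z: "z \<in> carrier (graph_monoid E)" "x \<otimes>\<^bsub>graph_monoid E\<^esub> z = y"
      by (auto simp: alg_le_def)
    obtain a b where ab: "a \<in> carrier ?F" "b \<in> carrier ?F" "x = graph_class a" "z = graph_class b"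
      using xy(1) z(1) ex by meson
    then have ab': "a + b \<in> carrier ?F" by auto
    have "graph_class (a + b) \<in> order_ideal" using mult_graph_monoid[OF ab(1,2)] ab z that(2) by simp
    then show ?thesis
      using graph_class_mem_order_ideal[OF ab(1)] graph_class_mem_order_ideal[OF ab'] ab(3)
      by (simp add: image_Un)
  qed
  ultimately show ?thesis
    unfolding gamma_order_ideal_def submonoid_def using sub by blast
qed

end


section \<open>Conditions (L) and (K)\<close>

text \<open>Each vertex on a cycle without exit emits only its cycle edge, so (A1) equates it with
  the next vertex shifted by one degree.\<close>

lemma condition_L_if_not_periodic:
  assumes wf: "wf_digraph E"
    and np: "\<forall>a\<in>nonzero (free_gamma_monoid E). \<not> periodic_sum E a"
  shows "condition_L E"
  unfolding condition_L_def
proof (intro allI impI, rule ccontr)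
  interpret wf_digraph E by (rule wf)
  fix p assume p: "graph_cycle E p" and no_exit: "\<not> has_exit E p"
  from p obtain v where v: "p \<noteq> []" "awalk v p v" "distinct (map (tail E) p)"
    by (auto simp: graph_cycle_def)
  let ?c = "\<lambda>v. monomial 0 (Proper v)"
  have "(?c (tail E e), act (free_gamma_monoid E) 1 (?c (head E e))) \<in> graph_congruence E"
    if e: "e \<in> set p" for e
  proof -
    have "f = e" if "f \<in> out_arcs E (tail E e)" for f
    proof -
      have "f \<in> set p" using no_exit e that unfolding has_exit_def by blast
      then show ?thesis using v(3) e that by (auto simp: distinct_map inj_on_def)
    qed
    moreover have eE: "e \<in> arcs E" using v(2) e by auto
    ultimately have out: "out_arcs E (tail E e) = {e}" by auto
    then have "regular_vertex E (tail E e)"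
      using tail_in_verts[OF eE] by (simp add: regular_vertex_def)
    from arrow1.A1[of "{#}" E, OF _ this, of 0] out
    have "(?c (tail E e), monomial 1 (Proper (head E e))) \<in> arrow1 E" by simp
    then show ?thesis using arrow1_graph_congruence by auto
  qed
  from act_power_along_walk[OF gamma_monoid_free gamma_congruence_graph[OF wf] _ v(2) this]
  have "(?c v, act (free_gamma_monoid E) (int (length p)) (?c v)) \<in> graph_congruence E"
    by (simp add: generators_def)
  then have "periodic_sum E (?c v)" using v(1) unfolding periodic_sum_def
    by (metis length_greater_0_conv of_nat_0_less_iff)
  moreover have "?c v \<in> nonzero (free_gamma_monoid E)"
    using awalk_hd_in_verts[OF v(2)] by (simp add: nonzero_def generators_def) (simp add: monomial_def)
  ultimately show False using np by blast
qed

lemma saturated_generators_empty: "wf_digraph E \<Longrightarrow> saturated_generators E {}"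
  by (auto simp: saturated_generators_def saturated_generators_axioms_def regular_vertex_def)

lemma not_periodic_if_condition_L:
  assumes wf: "wf_digraph E" and L: "condition_L E"
    and a: "a \<in> nonzero (free_gamma_monoid E)"
  shows "\<not> periodic_sum E a"
proof
  interpret saturated_generators E "{}" by (rule saturated_generators_empty[OF wf])
  assume "periodic_sum E a"
  then obtain n where n: "n > 0" "(a, act (free_gamma_monoid E) n a) \<in> graph_congruence E"
    by (auto simp: periodic_sum_def)
  have "a \<in> carrier (free_gamma_monoid E)" "\<not> snd ` set_mset a \<subseteq> {}"
    using a by (auto simp: nonzero_def)
  from cycle_if_periodic[OF this, of "{#}" "{#}" n] n obtain p where p: "graph_cycle E p"
    "\<And>e f. e \<in> set p \<Longrightarrow> f \<in> out_arcs E (tail E e) \<Longrightarrow> f \<noteq> e \<Longrightarrow> Proper (head E f) \<in> {}"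
    by (simp del: in_out_arcs_conv) blast
  then have "\<not> has_exit E p" unfolding has_exit_def by blast
  with L p(1) show False by (auto simp: condition_L_def)
qed

lemma graph_monoid_acts_freely_iff:
  assumes wf: "wf_digraph E"
  shows "acts_freely_on (graph_monoid E) (nonzero (graph_monoid E)) \<longleftrightarrow>
    (\<forall>a\<in>nonzero (free_gamma_monoid E). \<not> periodic_sum E a)"
proof -
  interpret saturated_generators E "{}" by (rule saturated_generators_empty[OF wf])
  let ?F = "free_gamma_monoid E"
  \<comment> \<open>With \<open>H\<close> empty, \<open>graph_congruence_subset_iff\<close> shows
    that no nonzero sum is congruent to zero.\<close>
  have zero: "graph_class a = graph_class {#} \<longleftrightarrow> a = {#}" if "a \<in> carrier ?F" for a
    using graph_class_eq_iff[OF that, of "{#}"] graph_congruence_subset_iff[of a "{#}"] by auto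
  have "nonzero (graph_monoid E) = graph_class ` nonzero ?F"
  proof (rule subset_antisym; rule subsetI)
    fix x assume "x \<in> nonzero (graph_monoid E)"
    then obtain a where "a \<in> carrier ?F" "x = graph_class a" "graph_class a \<noteq> graph_class {#}"
      unfolding nonzero_def carrier_graph_monoid one_graph_monoid by blast
    then show "x \<in> graph_class ` nonzero ?F" by (auto simp: nonzero_def)
  next
    fix x assume "x \<in> graph_class ` nonzero ?F"
    then obtain a where x: "x = graph_class a" and "a \<in> nonzero ?F" by blast
    then have "a \<in> carrier ?F" "a \<noteq> {#}" by (simp_all add: nonzero_def)
    then show "x \<in> nonzero (graph_monoid E)"
      using zero unfolding x nonzero_def carrier_graph_monoid one_graph_monoid by blast
  qed
  moreover have "periodic (graph_monoid E) (graph_class a) \<longleftrightarrow> periodic_sum E a"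
    if "a \<in> nonzero ?F" for a
  proof -
    have a: "a \<in> carrier ?F" using that by (simp only: nonzero_def Diff_iff)
    then have a': "act ?F n a \<in> carrier ?F" for n by simp
    show ?thesis
      unfolding periodic_def periodic_sum_def act_graph_monoid[OF a] graph_class_eq_iff[OF a a'] ..
  qed
  ultimately show ?thesis
    unfolding acts_freely_iff_not_periodic[OF gamma_monoid_graph[OF wf]] by simp
qed

section \<open>Closed simple paths and Condition (K)\<close>

context wf_digraph
begin

text \<open>Within \<open>A\<close> the source determines the edge, so the walks can differ only in
  where they stop; both stop on first reaching \<open>v\<close>.\<close>

lemma walks_with_injective_tails_eq:
  assumes inj: "\<And>e f. e \<in> A \<Longrightarrow> f \<in> A \<Longrightarrow> tail G e = tail G f \<Longrightarrow> e = f"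
    and "cas u p v" "cas u q v" "set p \<subseteq> A" "set q \<subseteq> A"
    and "\<forall>e\<in>set p. tail G e \<noteq> v" "\<forall>e\<in>set q. tail G e \<noteq> v"
  shows "p = q"
  using assms(2-)
proof (induction p arbitrary: q u)
  case Nil
  then show ?case by (cases q) auto
next
  case (Cons e p)
  then obtain f r where q: "q = f # r" by (cases q) auto
  then have "e = f" using Cons.prems by (intro inj) auto
  with Cons q show ?case by auto
qed

text \<open>A walk that enters \<open>H\<close> cannot come back to the base \<open>v\<close> of the
  cycle. Every closed path at \<open>v\<close> thus stays on \<open>p\<close>, where each source has
  one edge, and only one closed simple path is left.\<close>

lemma not_condition_K_if_exits_closed:
  assumes p: "graph_cycle G p"
    and hered: "\<And>e. e \<in> arcs G \<Longrightarrow> tail G e \<in> H \<Longrightarrow> head G e \<in> H"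
    and tails: "\<And>e. e \<in> set p \<Longrightarrow> tail G e \<notin> H"
    and exits: "\<And>e f. e \<in> set p \<Longrightarrow> f \<in> out_arcs G (tail G e) \<Longrightarrow> f \<noteq> e \<Longrightarrow> head G f \<in> H"
  shows "\<not> condition_K G"
proof
  assume K: "condition_K G"
  from p obtain v where v: "p \<noteq> []" "awalk v p v" and dist: "distinct (map (tail G) p)"
    by (auto simp: graph_cycle_def)
  obtain e0 p' where p': "p = e0 # p'" using v(1) by (cases p) auto
  then have e0: "tail G e0 = v" using v(2) by (auto simp: awalk_Cons_iff)
  have "\<forall>e\<in>set (tl p). tail G e \<noteq> v" using dist e0 p' by (auto simp: image_iff)
  then have "closed_simple_path G v p" using v by (simp add: closed_simple_path_def)
  moreover have "v \<in> tail G ` set p" using p' e0 by auto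
  ultimately obtain q q' where q: "q \<noteq> q'" "closed_simple_path G v q" "closed_simple_path G v q'"
    using K unfolding condition_K_def by blast
  have leave: "u \<notin> H" if "cas u r v" "set r \<subseteq> arcs G" for u r
    using that
  proof (induction r arbitrary: u)
    case Nil
    then show ?case using tails[of e0] p' e0 by auto
  next
    case (Cons e r)
    then show ?case using hered[of e] by auto
  qed
  have succ: "head G e \<in> tail G ` set p" if e: "e \<in> set p" for e
  proof -
    obtain p1 p2 where "p = p1 @ e # p2" using e by (meson split_list)
    with v(2) have "awalk (head G e) p2 v" by (auto simp: awalk_Cons_iff)
    then show ?thesis
      using \<open>v \<in> tail G ` set p\<close> \<open>p = p1 @ e # p2\<close> by (cases p2) (auto simp: awalk_Cons_iff awalk_Nil_iff)
  qed
  have stay: "set r \<subseteq> set p" if "cas u r v" "set r \<subseteq> arcs G" "u \<in> tail G ` set p" for u r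
    using that
  proof (induction r arbitrary: u)
    case (Cons e r)
    from Cons.prems(3) obtain f where f: "f \<in> set p" "u = tail G f" by blast
    have "head G e \<notin> H" using leave[of "head G e" r] Cons.prems by auto
    then have "e = f" using exits[OF f(1), of e] Cons.prems f(2) by auto
    then show ?case using Cons.IH[of "head G e"] Cons.prems f succ[of e] by auto
  qed simp
  have inj: "e = f" if "e \<in> set p" "f \<in> set p" "tail G e = tail G f" for e f
    using dist that by (auto simp: distinct_map inj_on_def)
  have csp: "r \<noteq> []" "cas v r v" "set r \<subseteq> set p" "\<forall>e\<in>set (tl r). tail G e \<noteq> v"
    if "closed_simple_path G v r" for r
    using that stay[of v r] \<open>v \<in> tail G ` set p\<close> by (auto simp: closed_simple_path_def awalk_def)
  obtain f r where f: "q = f # r" using csp(1)[OF q(2)] by (cases q) auto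
  obtain f' r' where f': "q' = f' # r'" using csp(1)[OF q(3)] by (cases q') auto
  have "f = f'" using csp(2,3)[OF q(2)] csp(2,3)[OF q(3)] f f' by (intro inj) auto
  moreover have "r = r'"
    using csp[OF q(2)] csp[OF q(3)] f f' \<open>f = f'\<close>
    by (intro walks_with_injective_tails_eq[where A = "set p" and u = "head G f" and v = v] inj) auto
  ultimately show False using q(1) f f' by simp
qed

text \<open>In a shortest nonempty walk no edge after the first can start at \<open>v\<close>: the
  part before that edge would be a shorter walk to \<open>v\<close>, still nonempty because it keeps
  the first edge.\<close>

lemma walk_reaching_end_once:
  assumes "awalk u p v" "p \<noteq> []"
  obtains q where "awalk u q v" "q \<noteq> []" "\<forall>e\<in>set (tl q). tail G e \<noteq> v"
proof -
  define q where "q = (ARG_MIN length q. awalk u q v \<and> q \<noteq> [])"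
  have q: "awalk u q v" "q \<noteq> []"
    and min: "length q \<le> length r" if "awalk u r v" "r \<noteq> []" for r
    using arg_min_nat_lemma[of "\<lambda>q. awalk u q v \<and> q \<noteq> []" p length] assms that
    by (auto simp: q_def)
  have "tail G e \<noteq> v" if e: "e \<in> set (tl q)" for e
  proof
    assume "tail G e = v"
    moreover obtain a b where "tl q = a @ e # b" using e by (meson split_list)
    then have "q = (hd q # a) @ e # b" using q[OF assms] by (metis append_Cons list.collapse)
    ultimately have "awalk u (hd q # a) v" using q(1)[OF assms]
      by (metis awalk_append_iff awalk_Cons_iff)
    from min[OF this] \<open>q = (hd q # a) @ e # b\<close> show False
      by (metis Nil_is_append_conv append_is_Nil_conv length_append length_greater_0_conv
          less_add_same_cancel1 linorder_not_less list.distinct(1))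
  qed
  with q[OF assms] that show ?thesis by blast
qed

text \<open>Here \<open>p\<close> is the only closed simple path at \<open>v\<close>. A walk from an
  exit of \<open>p\<close> back to \<open>v\<close>, cut at its first visit to \<open>v\<close>,
  would complete an initial part of \<open>p\<close> to a second one.\<close>

lemma exits_do_not_return_if_not_condition_K:
  assumes "\<not> condition_K G"
  obtains v p where "p \<noteq> []" "awalk v p v"
    "\<And>e f r. e \<in> set p \<Longrightarrow> f \<in> out_arcs G (tail G e) \<Longrightarrow> f \<noteq> e \<Longrightarrow> \<not> awalk (head G f) r v"
proof -
  from assms obtain v w q where q: "closed_simple_path G w q" "v \<in> tail G ` set q"
    and unique: "\<And>p p'. closed_simple_path G v p \<Longrightarrow> closed_simple_path G v p' \<Longrightarrow> p = p'"
    unfolding condition_K_def by blast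
  from q(2) obtain e where e: "e \<in> set q" "v = tail G e" by blast
  then obtain q1 q2 where "q = q1 @ e # q2" by (meson split_list)
  with q(1) e have "awalk w q1 v" "awalk v (e # q2) w"
    by (auto simp: closed_simple_path_def awalk_Cons_iff)
  \<comment> \<open>\<open>q\<close> is based at \<open>w\<close>; rotated to start at
    \<open>v\<close> it is a closed walk that may still pass through \<open>v\<close> several
    times.\<close>
  then have "awalk v ((e # q2) @ q1) v" by (rule awalk_appendI[rotated])
  then obtain p where p: "awalk v p v" "p \<noteq> []" "\<forall>e\<in>set (tl p). tail G e \<noteq> v"
    by (rule walk_reaching_end_once) auto
  then have csp: "closed_simple_path G v p" by (simp add: closed_simple_path_def)
  have "\<not> awalk (head G f) r v" if e: "e \<in> set p" and f: "f \<in> out_arcs G (tail G e)" "f \<noteq> e" for e f r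
  proof
    assume r: "awalk (head G f) r v"
    obtain p1 p2 where p12: "p = p1 @ e # p2" using e by (meson split_list)
    \<comment> \<open>If \<open>f\<close> already ends in \<open>v\<close>, the return walk must be
      empty, whereas \<open>walk_reaching_end_once\<close> gives nonempty walks; hence the two
      cases.\<close>
    obtain r' where r': "awalk (head G f) r' v" "\<forall>e\<in>set r'. tail G e \<noteq> v"
    proof (cases "head G f = v")
      case True
      then show ?thesis using that[of "[]"] r by (auto simp: awalk_Nil_iff)
    next
      case False
      then have "r \<noteq> []" using r by (auto simp: awalk_Nil_iff)
      then obtain r' where r': "awalk (head G f) r' v" "r' \<noteq> []" "\<forall>e\<in>set (tl r'). tail G e \<noteq> v"
        using walk_reaching_end_once[OF r] by blast
      then obtain g t where "r' = g # t" by (cases r') auto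
      with r' False show ?thesis using that[of r'] by (auto simp: awalk_Cons_iff)
    qed
    have "awalk v p1 (tail G e)" using p(1) p12 by (auto simp: awalk_Cons_iff)
    moreover have "awalk (tail G e) (f # r') v" using f r' by (auto simp: awalk_Cons_iff)
    ultimately have "awalk v (p1 @ f # r') v" by (rule awalk_appendI)
    moreover have "\<forall>g\<in>set (tl (p1 @ f # r')). tail G g \<noteq> v"
      using p(3) r'(2) f p12 by (cases p1) auto
    ultimately have "closed_simple_path G v (p1 @ f # r')" by (simp add: closed_simple_path_def)
    from unique[OF csp this] p12 f(2) show False by simp
  qed
  with p that show ?thesis by blast
qed

end

lemma not_periodic_quotient_if_condition_K:
  assumes wf: "wf_digraph E" and K: "condition_K E"
    and I: "gamma_order_ideal (graph_monoid E) I"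
    and x: "x \<in> nonzero (ideal_quotient (graph_monoid E) I)"
  shows "\<not> periodic (ideal_quotient (graph_monoid E) I) x"
proof
  interpret wf_digraph E by (rule wf)
  let ?F = "free_gamma_monoid E" and ?M = "graph_monoid E"
  let ?H = "{g \<in> generators E. graph_class (monomial 0 g) \<in> I}"
  interpret saturated_generators E ?H by (rule saturated_generators_order_ideal[OF I])
  note M = gamma_monoid_graph[OF wf]
  assume per: "periodic (ideal_quotient ?M I) x"
  from x obtain y where "y \<in> carrier ?M" "y \<notin> I" "x = ideal_congruence ?M I `` {y}"
    unfolding nonzero_ideal_quotient[OF M I] by blast
  then obtain a where a: "a \<in> carrier ?F" "graph_class a \<notin> I" and y: "graph_class a \<in> carrier ?M"
    "x = ideal_congruence ?M I `` {graph_class a}"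
    unfolding carrier_graph_monoid by blast
  from per[unfolded y(2) periodic_ideal_quotient[OF M I y(1)]] obtain n where n: "n > 0"
    and "(graph_class a, act ?M n (graph_class a)) \<in> ideal_congruence ?M I" by blast
  then obtain s t where st: "s \<in> I" "t \<in> I"
    "graph_class a \<otimes>\<^bsub>?M\<^esub> s = act ?M n (graph_class a) \<otimes>\<^bsub>?M\<^esub> t"
    by (elim ideal_congruenceE)
  have "I \<subseteq> carrier ?M" using I by (simp add: gamma_order_ideal_def submonoid_def)
  with st obtain i j where ij: "i \<in> carrier ?F" "s = graph_class i" "j \<in> carrier ?F" "t = graph_class j"
    unfolding carrier_graph_monoid by blast
  have a': "act ?F n a \<in> carrier ?F" using a(1) by simp
  have "graph_class (a + i) = graph_class (act ?F n a + j)"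
    using st(3) unfolding ij act_graph_monoid[OF a(1)] mult_graph_monoid[OF a(1) ij(1)]
      mult_graph_monoid[OF a' ij(3)] .
  moreover have "a + i \<in> carrier ?F" "act ?F n a + j \<in> carrier ?F"
    using a(1) ij(1,3) by (simp_all add: image_Un)
  ultimately have cong: "(a + i, act ?F n a + j) \<in> graph_congruence E" using graph_class_eq_iff by blast
  have "\<not> snd ` set_mset a \<subseteq> ?H" using a graph_class_mem_order_ideal_iff[OF I] by blast
  moreover have "snd ` set_mset i \<subseteq> ?H" "snd ` set_mset j \<subseteq> ?H"
    using st ij graph_class_mem_order_ideal_iff[OF I] by blast+
  ultimately obtain p where p: "graph_cycle E p"
    "\<And>e. e \<in> set p \<Longrightarrow> Proper (tail E e) \<notin> ?H"
    "\<And>e f. e \<in> set p \<Longrightarrow> f \<in> out_arcs E (tail E e) \<Longrightarrow> f \<noteq> e \<Longrightarrow> Proper (head E f) \<in> ?H"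
    by (rule cycle_if_periodic[OF a(1) _ _ _ n cong]) (rule that)
  have "\<not> condition_K E"
    by (rule not_condition_K_if_exits_closed[where H = "{v. Proper v \<in> ?H}", OF p(1)])
      (use p head_mem in blast)+
  with K show False by contradiction
qed

text \<open>An improper vertex reaches \<open>v\<close> only through the edges outside its set
  \<open>Z\<close>. The set then satisfies the axioms because reaching \<open>v\<close> passes
  exactly to some edge, even at \<open>v\<close> itself as it lies on a closed walk.\<close>

lemma (in wf_digraph) saturated_generators_not_reaching:
  assumes p: "p \<noteq> []" "awalk v p v"
  shows "saturated_generators G ({Proper u | u. u \<in> verts G \<and> \<not> (\<exists>r. awalk u r v)} \<union>
    {Improper u Z | u Z. Improper u Z \<in> generators G \<and>
      (\<forall>e\<in>out_arcs G u - Z. \<not> (\<exists>r. awalk (head G e) r v))})"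
proof -
  define reach where "reach u \<longleftrightarrow> (\<exists>r. awalk u r v)" for u
  have reach_iff: "reach u \<longleftrightarrow> (\<exists>e\<in>out_arcs G u. reach (head G e))" for u
  proof
    assume "reach u"
    then obtain r where r: "awalk u r v" by (auto simp: reach_def)
    \<comment> \<open>Appending \<open>p\<close> guarantees a first edge, also when \<open>r\<close>
      is empty.\<close>
    then have "awalk u (r @ p) v" using p(2) by (rule awalk_appendI)
    moreover obtain e s where "r @ p = e # s" using p(1) by (cases "r @ p") auto
    ultimately show "\<exists>e\<in>out_arcs G u. reach (head G e)" by (auto simp: awalk_Cons_iff reach_def)
  next
    assume "\<exists>e\<in>out_arcs G u. reach (head G e)"
    then obtain e r where "e \<in> out_arcs G u" "awalk (head G e) r v" by (auto simp: reach_def)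
    then have "awalk u (e # r) v" by (auto simp: awalk_Cons_iff)
    then show "reach u" by (auto simp: reach_def)
  qed
  have head: "head G e \<in> verts G" if "e \<in> out_arcs G u" for e u using that by auto
  have "saturated_generators G ({Proper u | u. u \<in> verts G \<and> \<not> reach u} \<union>
    {Improper u Z | u Z. Improper u Z \<in> generators G \<and> (\<forall>e\<in>out_arcs G u - Z. \<not> reach (head G e))})"
    (is "saturated_generators G ?H")
  proof unfold_locales
    fix u assume "regular_vertex G u"
    then show "Proper u \<in> ?H \<longleftrightarrow> (\<forall>e\<in>out_arcs G u. Proper (head G e) \<in> ?H)"
      using reach_iff[of u] head[of _ u] by (auto simp: regular_vertex_def)
  next
    fix u Z assume u: "infinite_emitter G u" "finite Z" "Z \<noteq> {}" "Z \<subseteq> out_arcs G u"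
    then have "Improper u Z \<in> generators G" "u \<in> verts G"
      by (auto simp: generators_def infinite_emitter_def)
    then show "Proper u \<in> ?H \<longleftrightarrow> Improper u Z \<in> ?H \<and> (\<forall>e\<in>Z. Proper (head G e) \<in> ?H)"
      using reach_iff[of u] head[of _ u] u(4) by (auto simp: subset_iff)
  next
    fix u W Z assume u: "infinite_emitter G u" "finite W" "Z \<noteq> {}" "Z \<subset> W" "W \<subseteq> out_arcs G u"
    then have "Improper u Z \<in> generators G" "Improper u W \<in> generators G"
      using finite_subset[of Z W] by (auto simp: generators_def)
    then show "Improper u Z \<in> ?H \<longleftrightarrow> Improper u W \<in> ?H \<and> (\<forall>e\<in>W - Z. Proper (head G e) \<in> ?H)"
      using head[of _ u] u(4,5) by (auto simp: subset_iff)
  qed (auto simp: generators_def)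
  then show ?thesis by (simp only: reach_def)
qed

lemma condition_K_if_not_periodic_quotient:
  fixes E :: "('v, 'e) pre_digraph"
  assumes wf: "wf_digraph E"
    and np: "\<And>I x. gamma_order_ideal (graph_monoid E) I \<Longrightarrow>
      x \<in> nonzero (ideal_quotient (graph_monoid E) I) \<Longrightarrow>
      \<not> periodic (ideal_quotient (graph_monoid E) I) x"
  shows "condition_K E"
proof (rule ccontr)
  interpret wf_digraph E by (rule wf)
  let ?F = "free_gamma_monoid E" and ?M = "graph_monoid E"
  assume "\<not> condition_K E"
  then obtain v p where p: "p \<noteq> []" "awalk v p v"
    and exits: "\<And>e f r. e \<in> set p \<Longrightarrow> f \<in> out_arcs E (tail E e) \<Longrightarrow> f \<noteq> e \<Longrightarrow> \<not> awalk (head E f) r v"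
    by (rule exits_do_not_return_if_not_condition_K) blast
  define H where "H = {Proper u | u. u \<in> verts E \<and> \<not> (\<exists>r. awalk u r v)} \<union>
    {Improper u Z | u Z. Improper u Z \<in> generators E \<and>
      (\<forall>e\<in>out_arcs E u - Z. \<not> (\<exists>r. awalk (head E e) r v))}"
  interpret saturated_generators E H
    unfolding H_def by (rule saturated_generators_not_reaching[OF p])
  note M = gamma_monoid_graph[OF wf] and I = gamma_order_ideal
  let ?R = "ideal_congruence ?M order_ideal"
  let ?c = "\<lambda>v. graph_class (monomial 0 (Proper v))"
  have gen: "monomial m (Proper u) \<in> carrier ?F" if "u \<in> verts E" for u m
    using that by (simp add: generators_def)
  have c: "?c u \<in> carrier ?M" if "u \<in> verts E" for u
    unfolding carrier_graph_monoid using gen[OF that] by (rule imageI)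
  have "(?c (tail E e), act ?M 1 (?c (head E e))) \<in> ?R" if e: "e \<in> set p" for e
  proof -
    have eE: "e \<in> arcs E" using p(2) e by auto
    then have he: "head E e \<in> verts E" and te: "tail E e \<in> verts E" by auto
    let ?h = "monomial 1 (Proper (head E e))"
    have exit: "Proper (head E f) \<in> H" if "f \<in> out_arcs E (tail E e)" "f \<noteq> e" for f
      using exits[OF e that] that by (auto simp: H_def)
    \<comment> \<open>\<open>s\<close> is what the relation produces besides the head of
      \<open>e\<close>: the heads of the other edges at a regular vertex, and the improper vertex of
      \<open>{e}\<close> at an infinite emitter.\<close>
    obtain s where s: "snd ` set_mset s \<subseteq> H" "(monomial 0 (Proper (tail E e)), ?h + s) \<in> arrow1 E"
    proof (cases "finite (out_arcs E (tail E e))")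
      case True
      let ?s = "\<Sum>f\<in>out_arcs E (tail E e) - {e}. monomial 1 (Proper (head E f))"
      have "regular_vertex E (tail E e)" using True te eE by (auto simp: regular_vertex_def)
      from arrow1.A1[of "{#}" E, OF _ this, of 0]
      have "(monomial 0 (Proper (tail E e)),
        \<Sum>f\<in>out_arcs E (tail E e). monomial 1 (Proper (head E f))) \<in> arrow1 E" by simp
      moreover have "(\<Sum>f\<in>out_arcs E (tail E e). monomial 1 (Proper (head E f))) =
        (?h + ?s :: ('v, 'e) formal_sum)"
        using eE by (intro sum.remove True) simp
      ultimately have "(monomial 0 (Proper (tail E e)), ?h + ?s) \<in> arrow1 E"
        by (simp only:)
      moreover have "snd ` set_mset ?s \<subseteq> H" using True
        by (simp add: image_image image_subset_iff exit del: in_out_arcs_conv)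
      ultimately show ?thesis using that by blast
    next
      case False
      then have inf: "infinite_emitter E (tail E e)" using te by (simp add: infinite_emitter_def)
      then have "Improper (tail E e) {e} \<in> H"
        using eE exits[OF e] by (auto simp: H_def generators_def)
      then show ?thesis
        using that[of "monomial 0 (Improper (tail E e) {e})"]
          arrow1.A2[of "{#}" E "tail E e" "{e}" 0] inf eE by (simp add: add.commute)
    qed
    have sF: "s \<in> carrier ?F" using s(1) subset_generators by auto
    have "?c (tail E e) = graph_class (?h + s)" by (rule graph_class_eq_if_arrow1[OF s(2)])
    also have "\<dots> = act ?M 1 (?c (head E e)) \<otimes>\<^bsub>?M\<^esub> graph_class s"
      using mult_graph_monoid[OF gen[OF he] sF, of 1] act_graph_monoid[OF gen[OF he], of 1 0] by simp
    \<comment> \<open>Multiplying by the identity gives the left side the ideal summand required by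
      \<open>ideal_congruence\<close>.\<close>
    finally have "?c (tail E e) \<otimes>\<^bsub>?M\<^esub> \<one>\<^bsub>?M\<^esub> = act ?M 1 (?c (head E e)) \<otimes>\<^bsub>?M\<^esub> graph_class s"
      using comm_monoid.axioms(1)[OF gamma_monoid.axioms(1)[OF M]] c[OF te]
      by (metis monoid.r_one)
    moreover have "\<one>\<^bsub>?M\<^esub> \<in> order_ideal" using I by (simp add: gamma_order_ideal_def submonoid_def)
    moreover have "graph_class s \<in> order_ideal" using s(1) graph_class_mem_order_ideal[OF sF] by blast
    ultimately show ?thesis
      using c[OF te] gamma_monoid.act_closed[OF M c[OF he]] by (intro ideal_congruenceI)
  qed
  from act_power_along_walk[OF M gamma_congruence_ideal[OF M I] c p(2) this]
  have per: "(?c v, act ?M (int (length p)) (?c v)) \<in> ?R" by blast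
  have v: "v \<in> verts E" by (rule awalk_hd_in_verts[OF p(2)])
  have "periodic (ideal_quotient ?M order_ideal) (?R `` {?c v})"
    unfolding periodic_ideal_quotient[OF M I c[OF v]]
    using per p(1) by (intro exI[of _ "int (length p)"]) simp
  moreover have "Proper v \<notin> H" using p(2) by (auto simp: H_def)
  then have "?c v \<notin> order_ideal" using graph_class_mem_order_ideal[OF gen[OF v]] by simp
  then have "?R `` {?c v} \<in> nonzero (ideal_quotient ?M order_ideal)"
    unfolding nonzero_ideal_quotient[OF M I] using c[OF v] by blast
  ultimately show False using np[OF I] by blast
qed

theorem corollary5p9:
  fixes E :: "('v, 'e) pre_digraph"
  assumes "wf_digraph E"
  shows "((condition_L E \<longleftrightarrow> (\<forall>a \<in> nonzero (free_gamma_monoid E). \<not> periodic_sum E a)) \<and>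
      ((\<forall>a \<in> nonzero (free_gamma_monoid E). \<not> periodic_sum E a) \<longleftrightarrow>
        acts_freely_on (graph_monoid E) (nonzero (graph_monoid E)))) \<and>
    ((condition_K E \<longleftrightarrow>
        (\<forall>I. gamma_order_ideal (graph_monoid E) I \<longrightarrow>
          (\<forall>a \<in> nonzero (ideal_quotient (graph_monoid E) I).
            \<not> periodic (ideal_quotient (graph_monoid E) I) a))) \<and>
      ((\<forall>I. gamma_order_ideal (graph_monoid E) I \<longrightarrow>
          (\<forall>a \<in> nonzero (ideal_quotient (graph_monoid E) I).
            \<not> periodic (ideal_quotient (graph_monoid E) I) a)) \<longleftrightarrow>
        (\<forall>I. gamma_order_ideal (graph_monoid E) I \<longrightarrow>
          acts_freely_on (ideal_quotient (graph_monoid E) I)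
            (nonzero (ideal_quotient (graph_monoid E) I)))))"
proof (intro conjI)
  show "condition_L E \<longleftrightarrow> (\<forall>a \<in> nonzero (free_gamma_monoid E). \<not> periodic_sum E a)"
    using condition_L_if_not_periodic[OF assms] not_periodic_if_condition_L[OF assms] by blast
  show "(\<forall>a \<in> nonzero (free_gamma_monoid E). \<not> periodic_sum E a) \<longleftrightarrow>
      acts_freely_on (graph_monoid E) (nonzero (graph_monoid E))"
    by (rule graph_monoid_acts_freely_iff[OF assms, symmetric])
  show "condition_K E \<longleftrightarrow>
      (\<forall>I. gamma_order_ideal (graph_monoid E) I \<longrightarrow>
        (\<forall>a \<in> nonzero (ideal_quotient (graph_monoid E) I).
          \<not> periodic (ideal_quotient (graph_monoid E) I) a))"
    using condition_K_if_not_periodic_quotient[OF assms]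
      not_periodic_quotient_if_condition_K[OF assms] by blast
  show "(\<forall>I. gamma_order_ideal (graph_monoid E) I \<longrightarrow>
        (\<forall>a \<in> nonzero (ideal_quotient (graph_monoid E) I).
          \<not> periodic (ideal_quotient (graph_monoid E) I) a)) \<longleftrightarrow>
      (\<forall>I. gamma_order_ideal (graph_monoid E) I \<longrightarrow>
        acts_freely_on (ideal_quotient (graph_monoid E) I)
          (nonzero (ideal_quotient (graph_monoid E) I)))"
    using acts_freely_iff_not_periodic[OF gamma_monoid_ideal_quotient[OF assms]] by blast
qed

end
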